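(* Let $A$ be an $n\times n$ Hermitian matrix of rank $r\le n$ with eigenvalues ordered so that $\lambda_1\ge\dots\ge\lambda_r$ are its nonzero eigenvalues and $\lambda_{r+1}=\dots=\lambda_n=0$, and let $E$ be an $n\times n$ Hermitian matrix. Let $A_1,A_2$ be $n\times n$ matrices such that $A=A_1A_2=A_2A_1$, and suppose $k=\|A_1^{+}EA_2^{+}\|\le 1$. Then for every $i\in\{1,\dots,r\}$, $$\lambda_{n-r+i}(A+E)\le \lambda_i+k|\lambda_i|\qquad\text{and}\qquad \lambda_i(A+E)\ge \lambda_i-k|\lambda_i|,$$ where the eigenvalues of $A+E$ are in decreasing order $\lambda_1(A+E)\ge\dots\ge\lambda_n(A+E)$.
   Context: All matrices are complex. $\|\cdot\|$ is the matrix 2-norm (largest singular value) and $X^{+}$ is the Moore-Penrose pseudo-inverse. Eigenvalues are counted with multiplicity. *)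

theory Defs
  imports
    "HOL-Library.Multiset"
    "Jordan_Normal_Form.Char_Poly"
    "Jordan_Normal_Form.Schur_Decomposition"
    "Jordan_Normal_Form.DL_Rank"
begin

definition hermitian_mat :: "complex mat \<Rightarrow> bool" where
  "hermitian_mat A \<longleftrightarrow> mat_adjoint A = A"

definition singular_values :: "complex mat \<Rightarrow> real set" where
  "singular_values A =
     {s. 0 \<le> s \<and> eigenvalue (mat_adjoint A * A) (complex_of_real (s ^ 2))}"

text \<open>The matrix 2-norm; unspecified for matrices without columns.\<close>

definition norm2_mat :: "complex mat \<Rightarrow> real" where
  "norm2_mat A = Max (singular_values A)"

text \<open>The Moore-Penrose pseudo-inverse, characterised by the four Penrose equations.\<close>

definition is_pinv :: "complex mat \<Rightarrow> complex mat \<Rightarrow> bool" where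
  "is_pinv A X \<longleftrightarrow>
     X \<in> carrier_mat (dim_col A) (dim_row A) \<and>
     A * X * A = A \<and> X * A * X = X \<and>
     hermitian_mat (A * X) \<and> hermitian_mat (X * A)"

definition pinv :: "complex mat \<Rightarrow> complex mat" where
  "pinv A = (THE X. is_pinv A X)"

text \<open>The eigenvalues with (algebraic) multiplicity.\<close>

definition eigvals_mset :: "complex mat \<Rightarrow> complex multiset" where
  "eigvals_mset A = proots (char_poly A)"

text \<open>The \<open>i\<close>-th largest eigenvalue of a Hermitian matrix, counted with multiplicity and
  indexed from 1. The eigenvalues are real, so taking real parts loses nothing.\<close>

definition eigval_desc :: "complex mat \<Rightarrow> nat \<Rightarrow> real" where
  "eigval_desc A i =
     rev (sorted_list_of_multiset (image_mset Re (eigvals_mset A))) ! (i - 1)"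

end

theory Submission
  imports Defs
begin

text \<open>Write \<open>P\<close> for the orthogonal projection onto the range of \<open>A\<close> and \<open>|A|\<close> for the positive
square root of \<open>A\<^sup>2\<close>. Everything follows from the relative bound
\<open>|x\<^sup>* E x| \<le> k x\<^sup>* |A| x\<close> for all \<open>x\<close> in the range of \<open>A\<close>
(\<open>relative_perturbation_bound\<close>).

Granting it, let \<open>u\<^sub>1, ..., u\<^sub>n\<close> and \<open>v\<^sub>1, ..., v\<^sub>n\<close> be orthonormal eigenbases of \<open>A\<close> and of
\<open>A + E\<close>, both indexed as the eigenvalues are. The span of \<open>u\<^sub>1, ..., u\<^sub>i\<close> and the span of
\<open>v\<^sub>i, ..., v\<^sub>n\<close> have dimensions adding up to \<open>n + 1\<close>, so they share a nonzero \<open>x\<close>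
(\<open>spectral_subspaces_intersect\<close>). On it the form of \<open>A + E\<close> is at most \<open>\<lambda>\<^sub>i(A + E) |x|\<^sup>2\<close>, and at
least \<open>(\<lambda>\<^sub>i - k |\<lambda>\<^sub>i|) |x|\<^sup>2\<close>, because \<open>t - k |t|\<close> is nondecreasing in \<open>t\<close> when \<open>k \<le> 1\<close>. The
upper estimate uses the spans of \<open>u\<^sub>i, ..., u\<^sub>r\<close> and of \<open>v\<^sub>1, ..., v\<^bsub>n-r+i\<^esub>\<close> in the same way; the
first of them stays inside the range of \<open>A\<close>, which is what costs the shift by \<open>n - r\<close>.

For the relative bound let \<open>T\<close> be \<open>|A|\<close> to the power \<open>-1/2\<close> on the range of \<open>A\<close> and \<open>0\<close> on its
kernel. The bound says that the Hermitian matrix \<open>G = T E T\<close> has norm at most \<open>k\<close>, and the norm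
of a Hermitian matrix is its spectral radius. The spectral radius does not change under
similarity, and this is how the non-normal factors can be handled. Since \<open>A\<^sub>1\<close> and \<open>A\<^sub>2\<close> commute
with \<open>A\<close>, they commute with every function of \<open>A\<close> (\<open>spectral_mat_commute\<close>), and the
compression to the range of \<open>A\<close> turns their pseudo-inverses into honest inverses:
\<open>P A\<^sub>1\<^sup>+ = A\<^sup>+ A\<^sub>2\<close> and \<open>A\<^sub>2\<^sup>+ P = A\<^sub>1 A\<^sup>+\<close> (\<open>pinv_compressed_to_range\<close>). If \<open>G z = t z\<close> with
\<open>t \<noteq> 0\<close>, then \<open>w = A\<^sub>2 T z\<close> is nonzero, lies in the range of \<open>A\<close>, and satisfies
\<open>P (A\<^sub>1\<^sup>+ E A\<^sub>2\<^sup>+) w = t sgn(A) w\<close>. The matrix \<open>sgn(A)\<close> is isometric on the range of \<open>A\<close>, so taking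
norms gives \<open>|t| \<le> k\<close>.

The remaining parts supply the spectral theorem for Hermitian matrices with the eigenvalues in
a prescribed order, the existence and uniqueness of the pseudo-inverse, and the fact that the
largest singular value bounds the matrix as an operator.
\<close>

section \<open>Adjoints, norms and quadratic forms\<close>

lemma mat_adjoint_index [simp]:
  assumes "i < dim_col A" "j < dim_row A"
  shows "mat_adjoint A $$ (i, j) = conjugate (A $$ (j, i))"
  using assms by (simp add: mat_adjoint_def mat_of_rows_def)

lemma dim_mat_adjoint [simp]:
  "dim_row (mat_adjoint A) = dim_col A" "dim_col (mat_adjoint A) = dim_row A"
  by (simp_all add: mat_adjoint_def)

lemma mat_adjoint_carrier [simp]:
  "A \<in> carrier_mat m n \<Longrightarrow> mat_adjoint A \<in> carrier_mat n m"
  by auto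

lemma mat_adjoint_adjoint [simp]: "mat_adjoint (mat_adjoint A) = A"
  by (rule eq_matI) auto

lemma mat_adjoint_one [simp]: "mat_adjoint (1\<^sub>m n :: complex mat) = 1\<^sub>m n"
  by (rule eq_matI) auto

lemma mat_adjoint_mult:
  fixes A B :: "complex mat"
  assumes "A \<in> carrier_mat m n" "B \<in> carrier_mat n l"
  shows "mat_adjoint (A * B) = mat_adjoint B * mat_adjoint A"
  by (rule eq_matI, insert assms, auto simp: scalar_prod_def mult.commute intro!: sum.cong)

lemma mat_adjoint_add:
  fixes A B :: "complex mat"
  assumes "A \<in> carrier_mat m n" "B \<in> carrier_mat m n"
  shows "mat_adjoint (A + B) = mat_adjoint A + mat_adjoint B"
  by (rule eq_matI, insert assms, auto)

lemma mat_adjoint_diag [simp]: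
  "mat_adjoint (mat_diag n (\<lambda>i. complex_of_real (d i))) = mat_diag n (\<lambda>i. complex_of_real (d i))"
  by (rule eq_matI, auto simp: mat_diag_def)

lemma inner_adjoint:
  fixes M :: "complex mat"
  assumes "M \<in> carrier_mat m n" "x \<in> carrier_vec n" "y \<in> carrier_vec m"
  shows "(M *\<^sub>v x) \<bullet>c y = x \<bullet>c (mat_adjoint M *\<^sub>v y)"
proof -
  have "(M *\<^sub>v x) \<bullet>c y = (\<Sum>i<m. \<Sum>j<n. M $$ (i,j) * x $ j * cnj (y $ i))"
    using assms by (auto simp: scalar_prod_def lessThan_atLeast0 sum_distrib_right intro!: sum.cong)
  also have "\<dots> = (\<Sum>j<n. \<Sum>i<m. M $$ (i,j) * x $ j * cnj (y $ i))"
    by (rule sum.swap)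
  also have "\<dots> = x \<bullet>c (mat_adjoint M *\<^sub>v y)"
    using assms by (auto simp: scalar_prod_def lessThan_atLeast0 sum_distrib_left intro!: sum.cong)
  finally show ?thesis .
qed

definition norm_sq :: "complex vec \<Rightarrow> real" where
  "norm_sq x = Re (x \<bullet>c x)"

definition quad_form :: "complex mat \<Rightarrow> complex vec \<Rightarrow> real" where
  "quad_form M x = Re ((M *\<^sub>v x) \<bullet>c x)"

lemma norm_sq_sum:
  assumes "x \<in> carrier_vec n"
  shows "norm_sq x = (\<Sum>i<n. (cmod (x $ i))\<^sup>2)"
  using assms by (auto simp: norm_sq_def scalar_prod_def lessThan_atLeast0 complex_mult_cnj cmod_power2
      intro!: sum.cong simp del: complex_cnj_mult)

lemma norm_sq_nonneg [simp]: "0 \<le> norm_sq x"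
  by (simp add: norm_sq_sum[of x "dim_vec x"] sum_nonneg)

lemma norm_sq_eq_0:
  assumes "x \<in> carrier_vec n"
  shows "norm_sq x = 0 \<longleftrightarrow> x = 0\<^sub>v n"
proof
  assume "norm_sq x = 0"
  then have "\<forall>i<n. cmod (x $ i) = 0"
    unfolding norm_sq_sum[OF assms] by (subst (asm) sum_nonneg_eq_0_iff) auto
  then show "x = 0\<^sub>v n" using assms by (intro eq_vecI) auto
qed (simp add: norm_sq_sum[of _ n])

lemma norm_sq_pos:
  assumes "x \<in> carrier_vec n" "x \<noteq> 0\<^sub>v n"
  shows "0 < norm_sq x"
  using norm_sq_eq_0[OF assms(1)] assms(2) norm_sq_nonneg[of x] by linarith

lemma norm_sq_smult: "norm_sq (c \<cdot>\<^sub>v x) = (cmod c)\<^sup>2 * norm_sq x"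
  by (simp add: norm_sq_sum[of _ "dim_vec x"] norm_mult power_mult_distrib sum_distrib_left)

lemma norm_sq_mult_mat_vec:
  assumes "M \<in> carrier_mat m n" "x \<in> carrier_vec n"
  shows "norm_sq (M *\<^sub>v x) = quad_form (mat_adjoint M * M) x"
proof -
  let ?y = "mat_adjoint M *\<^sub>v (M *\<^sub>v x)"
  have y: "?y \<in> carrier_vec n" using assms by (intro carrier_vecI) simp
  have "(M *\<^sub>v x) \<bullet>c (M *\<^sub>v x) = x \<bullet>c ?y"
    using assms by (intro inner_adjoint) auto
  also have "\<dots> = conjugate ?y \<bullet> x"
    using assms(2) y by (intro comm_scalar_prod[of _ n]) auto
  also have "\<dots> = conjugate (?y \<bullet>c x)"
    using conjugate_sprod_vec[OF y carrier_vec_conjugate[OF assms(2)]] by simp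
  finally show ?thesis
    using assms by (simp add: norm_sq_def quad_form_def assoc_mult_mat_vec[of _ n m _ n])
qed

lemma quad_form_conj:
  assumes "M \<in> carrier_mat n n" "T \<in> carrier_mat n m" "x \<in> carrier_vec m"
  shows "quad_form M (T *\<^sub>v x) = quad_form (mat_adjoint T * M * T) x"
proof -
  have 1: "(mat_adjoint T * M * T) *\<^sub>v x = mat_adjoint T *\<^sub>v (M *\<^sub>v (T *\<^sub>v x))"
    using assms by (simp add: assoc_mult_mat_vec[of _ m n _ m] assoc_mult_mat_vec[of _ m n _ n] mult_carrier_mat[of _ m n])
  have "(mat_adjoint T *\<^sub>v (M *\<^sub>v (T *\<^sub>v x))) \<bullet>c x = (M *\<^sub>v (T *\<^sub>v x)) \<bullet>c (T *\<^sub>v x)"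
    using inner_adjoint[of "mat_adjoint T" m n "M *\<^sub>v (T *\<^sub>v x)" x] assms by simp
  then show ?thesis by (simp add: quad_form_def 1)
qed

section \<open>Unitary matrices and the spectral theorem\<close>

definition unitary_mat :: "nat \<Rightarrow> complex mat \<Rightarrow> bool" where
  "unitary_mat n U \<longleftrightarrow> U \<in> carrier_mat n n \<and> mat_adjoint U * U = 1\<^sub>m n"

lemma unitary_matD:
  assumes "unitary_mat n U"
  shows "U \<in> carrier_mat n n" "mat_adjoint U \<in> carrier_mat n n"
    "mat_adjoint U * U = 1\<^sub>m n" "U * mat_adjoint U = 1\<^sub>m n"
  using assms mat_mult_left_right_inverse[of "mat_adjoint U" n U]
  by (auto simp: unitary_mat_def)

lemma unitary_mult_vec:
  assumes "unitary_mat n U" "x \<in> carrier_vec n"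
  shows "mat_adjoint U *\<^sub>v (U *\<^sub>v x) = x" "U *\<^sub>v (mat_adjoint U *\<^sub>v x) = x"
  using unitary_matD[OF assms(1)] assms(2)
  by (metis assoc_mult_mat_vec one_mult_mat_vec)+

lemma norm_sq_unitary:
  assumes "unitary_mat n U" "x \<in> carrier_vec n"
  shows "norm_sq (mat_adjoint U *\<^sub>v x) = norm_sq x"
  using norm_sq_mult_mat_vec[of "mat_adjoint U" n n x] unitary_matD[OF assms(1)] assms(2)
  by (simp add: quad_form_def norm_sq_def)

lemma unitary_mult:
  assumes "unitary_mat n U" "unitary_mat n V"
  shows "unitary_mat n (U * V)"
proof -
  note U = unitary_matD[OF assms(1)] and V = unitary_matD[OF assms(2)]
  have "mat_adjoint (U * V) * (U * V) = mat_adjoint V * ((mat_adjoint U * U) * V)"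
    using U(1,2) V(1,2) by (simp add: mat_adjoint_mult[of _ n n] assoc_mult_mat[of _ n n _ n _ n] mult_carrier_mat[of _ n n])
  then show ?thesis using U V by (simp add: unitary_mat_def)
qed

lemma inner_self:
  fixes x :: "complex vec"
  shows "x \<bullet>c x = complex_of_real (norm_sq x)"
proof -
  have "Im (x \<bullet>c x) = 0" by (simp add: scalar_prod_def)
  then show ?thesis by (simp add: norm_sq_def complex_eq_iff)
qed

text \<open>Completing \<open>v\<close> to a basis and orthogonalising keeps \<open>v\<close> in front; normalising the columns then
makes the matrix unitary, which is why \<open>v\<close> survives only up to a scalar factor.\<close>

lemma unitary_with_first_col:
  fixes v :: "complex vec"
  assumes v: "v \<in> carrier_vec n" "v \<noteq> 0\<^sub>v n"
  obtains W c where "unitary_mat n W" "col W 0 = c \<cdot>\<^sub>v v"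
proof -
  interpret cof_vec_space n "TYPE(complex)" .
  define b where "b = basis_completion v"
  define ws where "ws = gram_schmidt n b"
  note bc = basis_completion[OF v, folded b_def]
  have n: "n > 0" using v by (cases n) auto
  have bv: "b = v # tl b" using bc(6,7) n by (cases b) auto
  note gs = gram_schmidt_result[OF bc(2,4,5) ws_def]
  have len: "length ws = n" using gs(4) bc(6) by simp
  have "hd ws = v" using gram_schmidt_hd[OF v(1), of "tl b"] bv by (simp add: ws_def)
  then have ws0: "ws ! 0 = v" using len n by (cases ws) auto
  have wsc: "ws ! i \<in> carrier_vec n" if "i < n" for i using gs(3) len that by auto
  have orth: "(ws ! i \<bullet>c ws ! j = 0) = (i \<noteq> j)" if "i < n" "j < n" for i j
    using corthogonalD[OF gs(2)] that len by auto
  define s where "s i = complex_of_real (1 / sqrt (norm_sq (ws ! i)))" for i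
  define W where "W = mat n n (\<lambda>(i, j). s j * (ws ! j) $ i)"
  have colW: "col W j = s j \<cdot>\<^sub>v (ws ! j)" if "j < n" for j
    using that wsc[OF that] by (intro eq_vecI) (auto simp: W_def)
  have "mat_adjoint W * W = 1\<^sub>m n"
  proof (rule eq_matI)
    fix i j assume "i < dim_row (1\<^sub>m n :: complex mat)" "j < dim_col (1\<^sub>m n :: complex mat)"
    then have ij: "i < n" "j < n" by auto
    have rowW: "row (mat_adjoint W) i = conjugate (col W i)"
      using ij by (intro eq_vecI) (auto simp: W_def)
    have "(mat_adjoint W * W) $$ (i, j) = conjugate (col W i) \<bullet> col W j"
      using ij rowW by (simp add: W_def)
    also have "\<dots> = col W j \<bullet>c col W i"
      by (rule comm_scalar_prod[of _ n]) (simp_all add: W_def carrier_vecI)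
    also have "\<dots> = s j * cnj (s i) * (ws ! j \<bullet>c ws ! i)"
      using colW ij wsc by (simp add: conjugate_smult_vec smult_scalar_prod_distrib[of _ n]
          scalar_prod_smult_distrib[of _ n])
    also have "\<dots> = 1\<^sub>m n $$ (i, j)"
    proof (cases "i = j")
      case True
      have "norm_sq (ws ! i) > 0"
        using orth[of i i] ij norm_sq_nonneg[of "ws ! i"]
        by (simp add: inner_self less_le del: norm_sq_nonneg)
      then have "s i * cnj (s i) * complex_of_real (norm_sq (ws ! i)) = 1"
        by (simp add: s_def flip: of_real_mult)
      then show ?thesis using True ij inner_self[of "ws ! i"] by simp
    next
      case False
      then show ?thesis using orth[of j i] ij by simp
    qed
    finally show "(mat_adjoint W * W) $$ (i, j) = 1\<^sub>m n $$ (i, j)" .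
  qed (auto simp: W_def)
  then have "unitary_mat n W" by (simp add: unitary_mat_def W_def)
  moreover have "col W 0 = s 0 \<cdot>\<^sub>v v" using colW[OF n] ws0 by simp
  ultimately show thesis using that by blast
qed

lemma mat_adjoint_four_block:
  fixes A B C D :: "complex mat"
  assumes "A \<in> carrier_mat n1 m1" "B \<in> carrier_mat n1 m2" "C \<in> carrier_mat n2 m1" "D \<in> carrier_mat n2 m2"
  shows "mat_adjoint (four_block_mat A B C D) =
    four_block_mat (mat_adjoint A) (mat_adjoint C) (mat_adjoint B) (mat_adjoint D)"
  by (rule eq_matI, insert assms, auto)

text \<open>Schur's deflation: a unitary matrix whose first column is an eigenvector for \<open>e\<close> conjugates
\<open>A\<close> into a matrix with first column \<open>(e, 0, ..., 0)\<close>. Being Hermitian, the conjugate also has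
first row \<open>(e, 0, ..., 0)\<close>, so the induction continues with a Hermitian block of size \<open>n - 1\<close>.
As the eigenvalue split off is the head of the list, the diagonal comes out in any order in
which the characteristic polynomial is factored; the eigenvalue comparison at the end relies on
this freedom.\<close>

theorem hermitian_spectral_complex:
  assumes "A \<in> carrier_mat n n" "hermitian_mat A"
    and "char_poly A = (\<Prod>e\<leftarrow>es. [:- e, 1:])"
  shows "\<exists>U. unitary_mat n U \<and> A = U * mat_diag n (\<lambda>i. es ! i) * mat_adjoint U"
  using assms
proof (induction es arbitrary: n A)
  case Nil
  then have "n = 0" using degree_monic_char_poly[of A n] by simp
  then show ?case using Nil(1) by (intro exI[of _ A]) (auto simp: unitary_mat_def)
next
  case (Cons e es n A)
  note A = Cons.prems(1) and herm = Cons.prems(2) and cp = Cons.prems(3)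
  have mon: "monic (\<Prod>e\<leftarrow>es. [:- e, 1:])" by (rule monic_prod_list, auto)
  have "degree (char_poly A) = Suc (degree (\<Prod>e\<leftarrow>es. [:- e, 1:]))"
    unfolding cp list.map prod_list.Cons by (subst degree_mult_eq) (insert mon, auto)
  then obtain m where n: "n = Suc m" using degree_monic_char_poly[OF A] by (cases n) auto
  have "eigenvalue A e" unfolding eigenvalue_root_char_poly[OF A] cp by simp
  then obtain v where v: "v \<in> carrier_vec n" "v \<noteq> 0\<^sub>v n" "A *\<^sub>v v = e \<cdot>\<^sub>v v"
    using A by (auto simp: eigenvalue_def eigenvector_def)
  obtain W c where W: "unitary_mat n W" and W0: "col W 0 = c \<cdot>\<^sub>v v"
    using unitary_with_first_col[OF v(1,2)] by blast
  note Wc = unitary_matD[OF W]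
  define B where "B = mat_adjoint W * A * W"
  have B: "B \<in> carrier_mat n n" using Wc A by (simp add: B_def mult_carrier_mat[of _ n n])
  have WBW: "W * B * mat_adjoint W = A"
  proof -
    have "W * B * mat_adjoint W = (W * mat_adjoint W) * A * (W * mat_adjoint W)"
      using Wc(1,2) A by (simp add: B_def assoc_mult_mat[of _ n n _ n _ n] mult_carrier_mat[of _ n n])
    then show ?thesis using Wc A by simp
  qed
  have hB: "mat_adjoint B = B"
    using Wc(1,2) A herm by (simp add: B_def hermitian_mat_def mat_adjoint_mult[of _ n n _ n]
        assoc_mult_mat[of _ n n _ n _ n] mult_carrier_mat[of _ n n])
  have B0: "B $$ (i, 0) = (if i = 0 then e else 0)" if "i < n" for i
  proof -
    have n0: "0 < n" by (simp add: n)
    have "B = mat_adjoint W * (A * W)"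
      unfolding B_def by (rule assoc_mult_mat[OF Wc(2) A Wc(1)])
    then have "col B 0 = mat_adjoint W *\<^sub>v col (A * W) 0"
      using col_mult2[OF Wc(2) mult_carrier_mat[OF A Wc(1)] n0] by (simp only:)
    also have "col (A * W) 0 = A *\<^sub>v col W 0" by (rule col_mult2[OF A Wc(1) n0])
    also have "A *\<^sub>v col W 0 = e \<cdot>\<^sub>v col W 0"
      using A v by (simp add: W0 mult_mat_vec[of _ n n] smult_smult_assoc mult.commute)
    also have "mat_adjoint W *\<^sub>v (e \<cdot>\<^sub>v col W 0) = e \<cdot>\<^sub>v (mat_adjoint W *\<^sub>v col W 0)"
      using Wc(1) by (intro mult_mat_vec[OF Wc(2)] carrier_vecI) simp
    also have "mat_adjoint W *\<^sub>v col W 0 = col (mat_adjoint W * W) 0"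
      by (rule col_mult2[OF Wc(2,1), symmetric]) (simp add: n)
    also have "\<dots> = unit_vec n 0" using Wc n by simp
    finally have "col B 0 $ i = (e \<cdot>\<^sub>v unit_vec n 0) $ i" by simp
    then show ?thesis using B that n by auto
  qed
  have B0': "B $$ (0, j) = (if j = 0 then e else 0)" if "j < n" for j
  proof -
    have "B $$ (0, j) = cnj (B $$ (j, 0))"
      using mat_adjoint_index[of 0 B j] hB B that n by simp
    moreover have "cnj (B $$ (0, 0)) = B $$ (0, 0)"
      using mat_adjoint_index[of 0 B 0] hB B n by simp
    ultimately show ?thesis using B0 that n by auto
  qed
  define C where "C = mat m m (\<lambda>(i, j). B $$ (Suc i, Suc j))"
  have C: "C \<in> carrier_mat m m" by (simp add: C_def)
  let ?e = "mat 1 1 (\<lambda>_. e)"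
  have Bblock: "B = four_block_mat ?e (0\<^sub>m 1 m) (0\<^sub>m m 1) C"
    by (rule eq_matI) (insert B B0 B0' n, auto simp: C_def)
  have hC: "hermitian_mat C"
    unfolding hermitian_mat_def
  proof (rule eq_matI)
    fix i j assume "i < dim_row C" "j < dim_col C"
    then have ij: "i < m" "j < m" by (simp_all add: C_def)
    have "mat_adjoint B $$ (Suc i, Suc j) = cnj (B $$ (Suc j, Suc i))"
      using B n ij by simp
    then have "cnj (B $$ (Suc j, Suc i)) = B $$ (Suc i, Suc j)" unfolding hB by (rule sym)
    then show "mat_adjoint C $$ (i, j) = C $$ (i, j)" using ij by (simp add: C_def)
  qed (auto simp: C_def)
  have "similar_mat_wit A B W (mat_adjoint W)"
    by (rule similar_mat_witI[OF Wc(4) Wc(3) WBW[symmetric] A B Wc(1,2)])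
  then have "similar_mat A B" unfolding similar_mat_def by blast
  then have "char_poly A = char_poly B" by (rule char_poly_similar)
  also have "\<dots> = char_poly ?e * char_poly C"
    unfolding Bblock by (rule char_poly_four_block_zeros_col[OF _ _ C]) auto
  also have "char_poly ?e = [:- e, 1:]"
    by (simp add: char_poly_defs det_def sign_def)
  finally have "[:- e, 1:] * char_poly C = [:- e, 1:] * (\<Prod>e\<leftarrow>es. [:- e, 1:])"
    using cp by simp
  then have cpC: "char_poly C = (\<Prod>e\<leftarrow>es. [:- e, 1:])"
    by (subst (asm) mult_cancel_left) auto
  from Cons.IH[OF C hC cpC] obtain V where V: "unitary_mat m V"
    and CV: "C = V * mat_diag m (\<lambda>i. es ! i) * mat_adjoint V" by blast
  note Vc = unitary_matD[OF V]
  define Z where "Z = four_block_mat (1\<^sub>m 1) (0\<^sub>m 1 m) (0\<^sub>m m 1) V"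
  have Z: "Z \<in> carrier_mat n n" 
    using four_block_carrier_mat[OF one_carrier_mat[of 1] Vc(1)] n by (simp add: Z_def)
  have adjZ: "mat_adjoint Z = four_block_mat (1\<^sub>m 1) (0\<^sub>m 1 m) (0\<^sub>m m 1) (mat_adjoint V)"
  proof -
    have z: "mat_adjoint (0\<^sub>m a b) = (0\<^sub>m b a :: complex mat)" for a b by (rule eq_matI) auto
    show ?thesis
      unfolding Z_def by (subst mat_adjoint_four_block[of _ 1 1 _ m _ m]) (use Vc in \<open>auto simp: z\<close>)
  qed
  have uZ: "unitary_mat n Z"
    unfolding unitary_mat_def
    using Z Vc n four_block_one_mat[of 1 m]
    by (simp add: adjZ, simp add: Z_def mult_four_block_mat[of _ 1 1 _ m _ m _ _ 1 _ m])
  let ?D = "mat_diag n (\<lambda>i. (e # es) ! i)"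
  have D: "?D = four_block_mat ?e (0\<^sub>m 1 m) (0\<^sub>m m 1) (mat_diag m (\<lambda>i. es ! i))"
    by (rule eq_matI) (auto simp: mat_diag_def n nth_Cons')
  let ?d = "mat_diag m (\<lambda>i. es ! i)"
  have "Z * ?D = four_block_mat ?e (0\<^sub>m 1 m) (0\<^sub>m m 1) (V * ?d)"
    unfolding Z_def D
    by (subst mult_four_block_mat[of _ 1 1 _ m _ m _ _ 1 _ m])
      (use Vc in \<open>simp_all add: mult_carrier_mat[of _ m m] left_mult_zero_mat[of _ m m]\<close>)
  then have "Z * ?D * mat_adjoint Z = B"
    unfolding adjZ Bblock CV
    by (simp only:, subst mult_four_block_mat[of _ 1 1 _ m _ m _ _ 1 _ m])
      (use Vc in \<open>simp_all add: mult_carrier_mat[of _ m m] right_mult_zero_mat[of _ m m]\<close>)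
  then have "A = W * (Z * ?D * mat_adjoint Z) * mat_adjoint W" using WBW by simp
  also have "\<dots> = (W * Z) * ?D * mat_adjoint (W * Z)"
    using Wc Z by (simp add: mat_adjoint_mult[of _ n n] assoc_mult_mat[of _ n n _ n _ n] mult_carrier_mat[of _ n n])
  finally show ?case using unitary_mult[OF W uZ] by blast
qed

section \<open>Functions of a Hermitian matrix\<close>

text \<open>If \<open>A = spectral_mat U d\<close>, then \<open>spectral_mat U (\<lambda>i. f (d i))\<close> is the matrix \<open>f(A)\<close> of the
functional calculus.\<close>

definition spectral_mat :: "complex mat \<Rightarrow> (nat \<Rightarrow> real) \<Rightarrow> complex mat" where
  "spectral_mat U d = U * mat_diag (dim_row U) (\<lambda>i. complex_of_real (d i)) * mat_adjoint U"

context
  fixes n :: nat and U :: "complex mat"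
  assumes U: "unitary_mat n U"
begin

private lemmas Uc = unitary_matD[OF U]
private lemmas ring = assoc_mult_mat[of _ n n _ n _ n] mult_carrier_mat[of _ n n _ n]
  left_mult_one_mat[of _ n n] right_mult_one_mat[of _ n n] mult_mat_vec_carrier[of _ n n]

lemma spectral_mat_eq:
  "spectral_mat U d = U * mat_diag n (\<lambda>i. complex_of_real (d i)) * mat_adjoint U"
  using Uc by (simp add: spectral_mat_def)

lemma spectral_mat_carrier: "spectral_mat U d \<in> carrier_mat n n"
  using Uc by (simp add: spectral_mat_eq ring)

lemma spectral_mat_adjoint: "mat_adjoint (spectral_mat U d) = spectral_mat U d"
  using Uc(1,2) by (simp add: spectral_mat_eq mat_adjoint_mult[of _ n n _ n] ring)

lemma spectral_mat_mult: "spectral_mat U d * spectral_mat U e = spectral_mat U (\<lambda>i. d i * e i)"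
proof -
  let ?D = "\<lambda>d. mat_diag n (\<lambda>i. complex_of_real (d i))"
  have "spectral_mat U d * spectral_mat U e = U * (?D d * ((mat_adjoint U * U) * (?D e * mat_adjoint U)))"
    using Uc(1,2) by (simp add: spectral_mat_eq ring)
  also have "\<dots> = U * ((?D d * ?D e) * mat_adjoint U)"
    using Uc by (simp add: ring del: mat_diag_diag)
  also have "\<dots> = spectral_mat U (\<lambda>i. d i * e i)"
    using Uc(1,2) by (simp add: spectral_mat_eq ring)
  finally show ?thesis .
qed

text \<open>The entries of \<open>mat_adjoint U *\<^sub>v x\<close> are the coordinates of \<open>x\<close> in the orthonormal basis formed
by the columns of \<open>U\<close>; membership in a span of some of the columns is expressed below as the
vanishing of the other coordinates.\<close>

lemma spectral_mat_coords:
  assumes "x \<in> carrier_vec n" "i < n"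
  shows "(mat_adjoint U *\<^sub>v (spectral_mat U d *\<^sub>v x)) $ i = d i * (mat_adjoint U *\<^sub>v x) $ i"
proof -
  let ?D = "mat_diag n (\<lambda>i. complex_of_real (d i))"
  have c: "mat_adjoint U *\<^sub>v x \<in> carrier_vec n" using Uc assms by (simp add: ring)
  have "spectral_mat U d *\<^sub>v x = U *\<^sub>v (?D *\<^sub>v (mat_adjoint U *\<^sub>v x))"
    using Uc(1,2) assms by (simp add: spectral_mat_eq ring assoc_mult_mat_vec[of _ n n _ n])
  then have "mat_adjoint U *\<^sub>v (spectral_mat U d *\<^sub>v x) = ?D *\<^sub>v (mat_adjoint U *\<^sub>v x)"
    using unitary_mult_vec(1)[OF U, of "?D *\<^sub>v (mat_adjoint U *\<^sub>v x)"] c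
    by (simp add: ring)
  then show ?thesis
    using assms c Uc by (simp add: mat_diag_def scalar_prod_def if_distrib[of "\<lambda>t. t * _"] cong: if_cong)
qed

lemma norm_sq_coords:
  assumes "x \<in> carrier_vec n"
  shows "norm_sq x = (\<Sum>i<n. (cmod ((mat_adjoint U *\<^sub>v x) $ i))\<^sup>2)"
  using norm_sq_unitary[OF U assms] norm_sq_sum[of "mat_adjoint U *\<^sub>v x" n] Uc assms by simp

lemma norm_sq_spectral_mat:
  assumes "x \<in> carrier_vec n"
  shows "norm_sq (spectral_mat U d *\<^sub>v x) = (\<Sum>i<n. (d i)\<^sup>2 * (cmod ((mat_adjoint U *\<^sub>v x) $ i))\<^sup>2)"
proof -
  have "spectral_mat U d *\<^sub>v x \<in> carrier_vec n" using spectral_mat_carrier assms by (simp add: ring)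
  then show ?thesis
    using assms by (simp add: norm_sq_coords spectral_mat_coords norm_mult power_mult_distrib
      del: index_mult_mat_vec)
qed

lemma quad_form_spectral_mat:
  assumes "x \<in> carrier_vec n"
  shows "quad_form (spectral_mat U d) x = (\<Sum>i<n. d i * (cmod ((mat_adjoint U *\<^sub>v x) $ i))\<^sup>2)"
proof -
  let ?c = "mat_adjoint U *\<^sub>v x" and ?y = "spectral_mat U d *\<^sub>v x"
  have y: "?y \<in> carrier_vec n" and c: "?c \<in> carrier_vec n"
    using spectral_mat_carrier Uc assms by (simp_all add: ring)
  have "?y \<bullet>c x = ?y \<bullet>c (U *\<^sub>v ?c)" using unitary_mult_vec(2)[OF U assms] by simp
  also have "\<dots> = (mat_adjoint U *\<^sub>v ?y) \<bullet>c ?c"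
    using inner_adjoint[of "mat_adjoint U" n n ?y ?c] Uc y c by simp
  also have "\<dots> = (\<Sum>i<n. (mat_adjoint U *\<^sub>v ?y) $ i * cnj (?c $ i))"
    using c carrier_vecD[OF c] by (simp add: scalar_prod_def[of _ "conjugate _"] lessThan_atLeast0
        del: index_mult_mat_vec)
  also have "\<dots> = (\<Sum>i<n. complex_of_real (d i * (cmod (?c $ i))\<^sup>2))"
    by (intro sum.cong refl)
      (simp add: spectral_mat_coords[OF assms] mult.assoc complex_norm_square
        del: index_mult_mat_vec of_real_power)
  finally show ?thesis
    by (simp add: quad_form_def del: index_mult_mat_vec)
qed

lemma spectral_mat_col:
  assumes "i < n"
  shows "spectral_mat U d *\<^sub>v col U i = complex_of_real (d i) \<cdot>\<^sub>v col U i"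
    and "norm_sq (col U i) = 1" and "col U i \<in> carrier_vec n"
proof -
  have Uu: "mat_adjoint U *\<^sub>v col U i = unit_vec n i"
    unfolding col_mult2[OF Uc(2,1) assms, symmetric] Uc(3) using assms by simp
  show col: "col U i \<in> carrier_vec n" using Uc(1) by (intro carrier_vecI) simp
  show "norm_sq (col U i) = 1"
    using assms by (simp add: norm_sq_coords[OF col] Uu unit_vec_def if_distrib[of cmod] if_distrib[of "\<lambda>t. t\<^sup>2"] cong: if_cong)
  have y: "spectral_mat U d *\<^sub>v col U i \<in> carrier_vec n" using spectral_mat_carrier col by (simp add: ring)
  have "mat_adjoint U *\<^sub>v (spectral_mat U d *\<^sub>v col U i)
      = mat_adjoint U *\<^sub>v (complex_of_real (d i) \<cdot>\<^sub>v col U i)"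
  proof (rule eq_vecI)
    fix j assume "j < dim_vec (mat_adjoint U *\<^sub>v (complex_of_real (d i) \<cdot>\<^sub>v col U i))"
    then have j: "j < n" using Uc by simp
    show "(mat_adjoint U *\<^sub>v (spectral_mat U d *\<^sub>v col U i)) $ j
        = (mat_adjoint U *\<^sub>v (complex_of_real (d i) \<cdot>\<^sub>v col U i)) $ j"
      unfolding spectral_mat_coords[OF col j] mult_mat_vec[OF Uc(2) col] Uu
      using assms j by simp
  qed simp
  then show "spectral_mat U d *\<^sub>v col U i = complex_of_real (d i) \<cdot>\<^sub>v col U i"
    using unitary_mult_vec(2)[OF U y] unitary_mult_vec(2)[OF U smult_carrier_vec[THEN iffD2, OF col]]
    by metis
qed

lemma eigenvalue_spectral_mat:
  assumes "i < n"
  shows "eigenvalue (spectral_mat U d) (complex_of_real (d i))"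
proof -
  have "col U i \<noteq> 0\<^sub>v n"
    using spectral_mat_col(2,3)[OF assms] norm_sq_eq_0[of "col U i" n] by auto
  then show ?thesis
    using spectral_mat_col[OF assms] spectral_mat_carrier[of d]
    by (auto simp: eigenvalue_def eigenvector_def intro!: exI[of _ "col U i"])
qed

text \<open>In the eigenbasis commuting with a diagonal matrix means that an entry \<open>(i, j)\<close> can be nonzero
only if \<open>d i = d j\<close>, and then also \<open>f (d i) = f (d j)\<close>.\<close>

lemma spectral_mat_commute:
  assumes X: "X \<in> carrier_mat n n"
    and comm: "X * spectral_mat U d = spectral_mat U d * X"
  shows "X * spectral_mat U (\<lambda>i. f (d i)) = spectral_mat U (\<lambda>i. f (d i)) * X"
proof -
  let ?D = "\<lambda>d. mat_diag n (\<lambda>i. complex_of_real (d i))"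
  let ?Y = "mat_adjoint U * X * U"
  have Y: "?Y \<in> carrier_mat n n" using Uc X by (simp add: ring)
  have left: "?Y * ?D e = mat_adjoint U * (X * spectral_mat U e) * U" for e
  proof -
    have "mat_adjoint U * (X * spectral_mat U e) * U = mat_adjoint U * (X * (U * (?D e * (mat_adjoint U * U))))"
      using Uc(1,2) X by (simp add: spectral_mat_eq ring)
    then show ?thesis using Uc X by (simp add: ring)
  qed
  have right: "?D e * ?Y = mat_adjoint U * (spectral_mat U e * X) * U" for e
  proof -
    have "mat_adjoint U * (spectral_mat U e * X) * U = (mat_adjoint U * U) * (?D e * (mat_adjoint U * (X * U)))"
      using Uc(1,2) X by (simp add: spectral_mat_eq ring)
    then show ?thesis using Uc X by (simp add: ring)
  qed
  have "?Y * ?D d = ?D d * ?Y" unfolding left right comm ..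
  then have ij: "?Y $$ (i, j) * d j = d i * ?Y $$ (i, j)" if "i < n" "j < n" for i j
  proof -
    have "(?Y * ?D d) $$ (i, j) = (?D d * ?Y) $$ (i, j)"
      using \<open>?Y * ?D d = ?D d * ?Y\<close> by simp
    then show ?thesis
      using that unfolding mat_diag_mult_left[OF Y] mat_diag_mult_right[OF Y] by simp
  qed
  have "?Y * ?D (\<lambda>i. f (d i)) = ?D (\<lambda>i. f (d i)) * ?Y"
    unfolding mat_diag_mult_left[OF Y] mat_diag_mult_right[OF Y]
  proof (rule cong_mat)
    fix i j assume "i < n" "j < n"
    then have "?Y $$ (i, j) = 0 \<or> d i = d j" using ij[of i j] by (metis mult.commute mult_cancel_left of_real_eq_iff)
    then show "(\<lambda>(i, j). ?Y $$ (i, j) * complex_of_real (f (d j))) (i, j)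
       = (\<lambda>(i, j). complex_of_real (f (d i)) * ?Y $$ (i, j)) (i, j)"
      by (auto simp del: index_mult_mat)
  qed auto
  then have eq: "mat_adjoint U * (X * spectral_mat U (\<lambda>i. f (d i))) * U
      = mat_adjoint U * (spectral_mat U (\<lambda>i. f (d i)) * X) * U"
    unfolding left right .
  have cancel: "U * (mat_adjoint U * Z * U) * mat_adjoint U = Z" if "Z \<in> carrier_mat n n" for Z
  proof -
    have "U * (mat_adjoint U * Z * U) * mat_adjoint U = (U * mat_adjoint U) * Z * (U * mat_adjoint U)"
      using Uc(1,2) that by (simp add: ring)
    then show ?thesis using that by (simp only: Uc(4) left_mult_one_mat right_mult_one_mat)
  qed
  show ?thesis
    using arg_cong[OF eq, of "\<lambda>M. U * M * mat_adjoint U"] X spectral_mat_carrier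
    by (simp only: cancel ring)
qed

end

section \<open>Hermitian matrices and their ordered eigenvalues\<close>

lemma proots_linear_factors: "proots (\<Prod>a\<leftarrow>as. [:- a, 1:]) = mset (as :: complex list)"
proof -
  have "proots (\<Prod>p\<leftarrow>map (\<lambda>a. [:- a, 1:]) as. p) = (\<Sum>p\<leftarrow>map (\<lambda>a. [:- a, 1:]) as. proots p)"
    by (rule proots_prod_list) auto
  also have "\<dots> = mset as" by (induction as) (auto simp: o_def)
  finally show ?thesis by simp
qed

text \<open>The order of the linear factors is immaterial, so a multiset of eigenvalues can be enumerated
at will before the spectral theorem is applied.\<close>

lemma char_poly_eigvals_mset:
  assumes "A \<in> carrier_mat n n" "eigvals_mset A = mset es"
  shows "char_poly A = (\<Prod>a\<leftarrow>es. [:- a, 1:])"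
proof -
  obtain as where as: "char_poly A = (\<Prod>a\<leftarrow>as. [:- a, 1:])"
    using char_poly_factorized[OF assms(1)] by blast
  then have "mset as = mset es"
    using assms(2) proots_linear_factors[of as] by (simp add: eigvals_mset_def)
  then have "mset (map (\<lambda>a. [:- a, 1:]) as) = mset (map (\<lambda>a. [:- a, 1:]) es)" by simp
  then show ?thesis unfolding as by (metis prod_mset_prod_list)
qed

theorem hermitian_spectral:
  assumes A: "A \<in> carrier_mat n n" "hermitian_mat A"
    and d: "eigvals_mset A = image_mset (\<lambda>i. complex_of_real (d i)) (mset_set {..<n})"
  obtains U where "unitary_mat n U" "A = spectral_mat U d"
proof -
  let ?es = "map (\<lambda>i. complex_of_real (d i)) [0..<n]"
  have "eigvals_mset A = mset ?es" unfolding d by (simp add: lessThan_atLeast0)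
  from hermitian_spectral_complex[OF A char_poly_eigvals_mset[OF A(1) this]]
  obtain U where U: "unitary_mat n U" and AU: "A = U * mat_diag n (\<lambda>i. ?es ! i) * mat_adjoint U"
    by blast
  have "mat_diag n (\<lambda>i. ?es ! i) = mat_diag n (\<lambda>i. complex_of_real (d i))"
    by (rule eq_matI) (auto simp: mat_diag_def)
  then have "A = spectral_mat U d" using AU spectral_mat_eq[OF U] by simp
  then show thesis using that U by blast
qed

lemma hermitian_eigvals_real:
  assumes A: "A \<in> carrier_mat n n" "hermitian_mat A"
  obtains l where "length l = n" "eigvals_mset A = mset (map complex_of_real l)"
proof -
  obtain es where es: "char_poly A = (\<Prod>a\<leftarrow>es. [:- a, 1:])" "length es = n"
    using char_poly_factorized[OF A(1)] by blast
  obtain U where U: "unitary_mat n U" and AU: "A = U * mat_diag n (\<lambda>i. es ! i) * mat_adjoint U"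
    using hermitian_spectral_complex[OF A es(1)] by blast
  note Uc = unitary_matD[OF U]
  let ?D = "mat_diag n (\<lambda>i. es ! i)"
  have "mat_adjoint U * A * U = (mat_adjoint U * U) * ?D * (mat_adjoint U * U)"
    using Uc(1,2) unfolding AU by (simp add: assoc_mult_mat[of _ n n _ n _ n] mult_carrier_mat[of _ n n])
  then have D: "?D = mat_adjoint U * A * U"
    by (simp add: Uc(3) left_mult_one_mat[of _ n n] right_mult_one_mat[of _ n n])
  have hD: "mat_adjoint ?D = ?D"
    using Uc(1,2) A unfolding D
    by (simp add: hermitian_mat_def mat_adjoint_mult[of _ n n _ n] assoc_mult_mat[of _ n n _ n _ n] mult_carrier_mat[of _ n n])
  have "complex_of_real (Re (es ! i)) = es ! i" if "i < n" for i
    using arg_cong[OF hD, of "\<lambda>M. M $$ (i, i)"] that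
    by (simp add: mat_diag_def complex_eq_iff)
  then have "map complex_of_real (map Re es) = es"
    using es(2) by (intro nth_equalityI) auto
  then show thesis
    using that[of "map Re es"] es proots_linear_factors[of es] by (simp add: eigvals_mset_def)
qed

theorem hermitian_spectral_desc:
  assumes A: "A \<in> carrier_mat n n" "hermitian_mat A"
  obtains U where "unitary_mat n U" "A = spectral_mat U (\<lambda>i. eigval_desc A (Suc i))"
    "\<And>i j. i \<le> j \<Longrightarrow> j < n \<Longrightarrow> eigval_desc A (Suc j) \<le> eigval_desc A (Suc i)"
proof -
  obtain l where l: "length l = n" "eigvals_mset A = mset (map complex_of_real l)"
    using hermitian_eigvals_real[OF A] .
  have "image_mset Re (eigvals_mset A) = mset l"
    unfolding l mset_map by (simp add: multiset.map_comp o_def)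
  then have desc: "eigval_desc A (Suc i) = rev (sort l) ! i" for i
    by (simp add: eigval_desc_def)
  have "mset_set {..<n} = mset [0..<n]" by (simp add: lessThan_atLeast0)
  then have "image_mset (\<lambda>i. complex_of_real (eigval_desc A (Suc i))) (mset_set {..<n})
      = mset (map complex_of_real (map (\<lambda>i. rev (sort l) ! i) [0..<n]))"
    by (simp add: desc o_def multiset.map_comp)
  also have "map (\<lambda>i. rev (sort l) ! i) [0..<n] = rev (sort l)"
    using l(1) map_nth[of "rev (sort l)"] by simp
  also have "mset (map complex_of_real (rev (sort l))) = eigvals_mset A" by (simp add: l)
  finally obtain U where "unitary_mat n U" "A = spectral_mat U (\<lambda>i. eigval_desc A (Suc i))"
    using hermitian_spectral[OF A] by metis
  moreover have "eigval_desc A (Suc j) \<le> eigval_desc A (Suc i)" if "i \<le> j" "j < n" for i j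
    using that l(1) unfolding desc by (auto simp: rev_nth intro!: sorted_nth_mono)
  ultimately show thesis using that by blast
qed

section \<open>The pseudo-inverse and the 2-norm\<close>

lemma mat_eq_by_vec:
  assumes "A \<in> carrier_mat m n" "B \<in> carrier_mat m n"
    and "\<And>x. x \<in> carrier_vec n \<Longrightarrow> A *\<^sub>v x = B *\<^sub>v (x :: 'a :: comm_ring_1 vec)"
  shows "A = B"
proof (rule eq_matI)
  fix i j assume ij: "i < dim_row B" "j < dim_col B"
  have "(A *\<^sub>v unit_vec n j) $ i = (B *\<^sub>v unit_vec n j) $ i"
    using assms(3)[of "unit_vec n j"] by simp
  then show "A $$ (i, j) = B $$ (i, j)" using ij assms(1,2) by simp
qed (use assms in auto)

lemma gram_spectral:
  assumes M: "M \<in> carrier_mat m n"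
  obtains V d where "unitary_mat n V" "mat_adjoint M * M = spectral_mat V d" "\<And>i. i < n \<Longrightarrow> 0 \<le> d i"
proof -
  have H: "mat_adjoint M * M \<in> carrier_mat n n" using M by (simp add: mult_carrier_mat[of _ n m])
  have "hermitian_mat (mat_adjoint M * M)"
    using M by (simp add: hermitian_mat_def mat_adjoint_mult[of _ n m _ n])
  then obtain V where V: "unitary_mat n V"
    and MV: "mat_adjoint M * M = spectral_mat V (\<lambda>i. eigval_desc (mat_adjoint M * M) (Suc i))"
    using hermitian_spectral_desc[OF H] by metis
  define d where "d = (\<lambda>i. eigval_desc (mat_adjoint M * M) (Suc i))"
  have MV: "mat_adjoint M * M = spectral_mat V d" using MV by (simp add: d_def)
  have "0 \<le> d i" if "i < n" for i
  proof -
    note c = spectral_mat_col[OF V that]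
    have "norm_sq (M *\<^sub>v col V i) = quad_form (spectral_mat V d) (col V i)"
      using norm_sq_mult_mat_vec[OF M c(3)] by (simp add: MV)
    also have "\<dots> = d i * norm_sq (col V i)"
      using c(3) by (simp add: quad_form_def norm_sq_def c(1))
    finally show ?thesis using norm_sq_nonneg[of "M *\<^sub>v col V i"] c(2) by simp
  qed
  then show thesis using that V MV by blast
qed

lemma pinv_unique:
  assumes "is_pinv A X" "is_pinv A Y" and A: "A \<in> carrier_mat m n"
  shows "X = Y"
proof -
  have X: "X \<in> carrier_mat n m" "A * X * A = A" "X * A * X = X"
    "mat_adjoint (A * X) = A * X" "mat_adjoint (X * A) = X * A"
    and Y: "Y \<in> carrier_mat n m" "A * Y * A = A" "Y * A * Y = Y"
    "mat_adjoint (A * Y) = A * Y" "mat_adjoint (Y * A) = Y * A"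
    using assms by (auto simp: is_pinv_def hermitian_mat_def)
  have AX: "A * X \<in> carrier_mat m m" and AY: "A * Y \<in> carrier_mat m m"
    and XA: "X * A \<in> carrier_mat n n" and YA: "Y * A \<in> carrier_mat n n"
    using A X(1) Y(1) by (auto intro: mult_carrier_mat)
  have "A * X = (A * Y) * (A * X)"
    using assoc_mult_mat[OF AY A X(1)] Y(2) by simp
  then have "mat_adjoint (A * X) = mat_adjoint ((A * Y) * (A * X))" by simp
  also have "\<dots> = (A * X) * (A * Y)" by (simp only: mat_adjoint_mult[OF AY AX] X Y)
  also have "\<dots> = A * Y" using assoc_mult_mat[OF AX A Y(1)] X(2) by simp
  finally have 1: "A * X = A * Y" unfolding X .
  have "X * A = (X * A) * (Y * A)"
    using assoc_mult_mat[OF X(1) A YA] assoc_mult_mat[OF A Y(1) A] Y(2) by simp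
  then have "mat_adjoint (X * A) = mat_adjoint ((X * A) * (Y * A))" by simp
  also have "\<dots> = (Y * A) * (X * A)" by (simp only: mat_adjoint_mult[OF XA YA] X Y)
  also have "\<dots> = Y * A"
    using assoc_mult_mat[OF Y(1) A XA] assoc_mult_mat[OF A X(1) A] X(2) by simp
  finally have 2: "X * A = Y * A" unfolding X .
  have "X = X * (A * X)" using X(3) assoc_mult_mat[OF X(1) A X(1)] by simp
  also have "\<dots> = X * A * Y" unfolding 1 by (rule assoc_mult_mat[OF X(1) A Y(1), symmetric])
  also have "\<dots> = Y" unfolding 2 by (rule Y(3))
  finally show ?thesis .
qed

text \<open>The pseudo-inverse is \<open>(M\<^sup>* M)\<^sup>+ M\<^sup>*\<close>, where the pseudo-inverse of the Hermitian matrix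
\<open>M\<^sup>* M\<close> inverts its nonzero eigenvalues; here \<open>inverse 0 = 0\<close> is the convention that is wanted.\<close>

lemma pinv_exists:
  assumes M: "M \<in> carrier_mat m n"
  shows "\<exists>X. is_pinv M X"
proof -
  obtain V d where V: "unitary_mat n V" and H: "mat_adjoint M * M = spectral_mat V d"
    using gram_spectral[OF M] by metis
  define G where "G = spectral_mat V (\<lambda>i. inverse (d i))"
  define Q where "Q = spectral_mat V (\<lambda>i. inverse (d i) * d i)"
  have G: "G \<in> carrier_mat n n" "mat_adjoint G = G" and Q: "Q \<in> carrier_mat n n" "mat_adjoint Q = Q"
    by (simp_all add: G_def Q_def spectral_mat_carrier[OF V] spectral_mat_adjoint[OF V])
  have M': "mat_adjoint M \<in> carrier_mat n m" using M by simp
  have GH: "G * (mat_adjoint M * M) = Q"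
    by (simp add: G_def H Q_def spectral_mat_mult[OF V])
  have HQ: "(mat_adjoint M * M) * Q = mat_adjoint M * M"
  proof -
    have "d i * (inverse (d i) * d i) = d i" for i by (cases "d i = 0") simp_all
    then have "(\<lambda>i. d i * (inverse (d i) * d i)) = d" by (rule ext)
    then show ?thesis by (simp add: H Q_def spectral_mat_mult[OF V])
  qed
  have QG: "Q * G = G"
  proof -
    have "inverse (d i) * d i * inverse (d i) = inverse (d i)" for i by (cases "d i = 0") simp_all
    then have "(\<lambda>i. inverse (d i) * d i * inverse (d i)) = (\<lambda>i. inverse (d i))" by (rule ext)
    then show ?thesis by (simp add: G_def Q_def spectral_mat_mult[OF V])
  qed
  \<comment> \<open>\<open>Q\<close> projects onto the range of \<open>M\<^sup>* M\<close>, and \<open>M\<close> vanishes on the kernel of \<open>M\<^sup>* M\<close>.\<close>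
  have MQ: "M * Q = M"
  proof (rule mat_eq_by_vec[of _ m n])
    fix x :: "complex vec" assume x: "x \<in> carrier_vec n"
    have Qx: "Q *\<^sub>v x \<in> carrier_vec n" by (rule mult_mat_vec_carrier[OF Q(1) x])
    have y: "x - Q *\<^sub>v x \<in> carrier_vec n" using x Qx by simp
    have Hc: "mat_adjoint M * M \<in> carrier_mat n n" unfolding H by (rule spectral_mat_carrier[OF V])
    have "(mat_adjoint M * M) *\<^sub>v (x - Q *\<^sub>v x) = (mat_adjoint M * M) *\<^sub>v x - (mat_adjoint M * M) *\<^sub>v (Q *\<^sub>v x)"
      by (rule mult_minus_distrib_mat_vec[OF Hc x Qx])
    also have "(mat_adjoint M * M) *\<^sub>v (Q *\<^sub>v x) = (mat_adjoint M * M) *\<^sub>v x"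
      using assoc_mult_mat_vec[OF Hc Q(1) x] HQ by simp
    also have "(mat_adjoint M * M) *\<^sub>v x - (mat_adjoint M * M) *\<^sub>v x = 0\<^sub>v n"
      using mult_mat_vec_carrier[OF Hc x] by (rule minus_cancel_vec)
    finally have "norm_sq (M *\<^sub>v (x - Q *\<^sub>v x)) = 0"
      using y by (simp add: norm_sq_mult_mat_vec[OF M y] quad_form_def)
    then have "M *\<^sub>v (x - Q *\<^sub>v x) = 0\<^sub>v m"
      using norm_sq_eq_0[OF mult_mat_vec_carrier[OF M y]] by simp
    then have 0: "M *\<^sub>v x - M *\<^sub>v (Q *\<^sub>v x) = 0\<^sub>v m"
      using mult_minus_distrib_mat_vec[OF M x Qx] by simp
    have "M *\<^sub>v x = M *\<^sub>v (Q *\<^sub>v x)"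
    proof (rule eq_vecI)
      fix i assume "i < dim_vec (M *\<^sub>v (Q *\<^sub>v x))"
      then have "i < m" using M by simp
      then show "(M *\<^sub>v x) $ i = (M *\<^sub>v (Q *\<^sub>v x)) $ i"
        using arg_cong[OF 0, of "\<lambda>v. v $ i"] M by (simp del: index_mult_mat_vec)
    qed simp
    then show "(M * Q) *\<^sub>v x = M *\<^sub>v x" using assoc_mult_mat_vec[OF M Q(1) x] by simp
  qed (use M Q in auto)
  have GM: "G * mat_adjoint M \<in> carrier_mat n m" using G M' by auto
  have XM: "G * mat_adjoint M * M = Q" using assoc_mult_mat[OF G(1) M' M] GH by simp
  have "is_pinv M (G * mat_adjoint M)"
    unfolding is_pinv_def hermitian_mat_def
  proof (intro conjI)
    show "G * mat_adjoint M \<in> carrier_mat (dim_col M) (dim_row M)" using GM M by auto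
    show "M * (G * mat_adjoint M) * M = M"
      using assoc_mult_mat[OF M GM M] XM MQ by simp
    show "G * mat_adjoint M * M * (G * mat_adjoint M) = G * mat_adjoint M"
      unfolding XM using assoc_mult_mat[OF Q(1) G(1) M'] QG by simp
    show "mat_adjoint (M * (G * mat_adjoint M)) = M * (G * mat_adjoint M)"
      using assoc_mult_mat[OF M G(1) M'] by (simp add: mat_adjoint_mult[OF M GM] mat_adjoint_mult[OF G(1) M'] G)
    show "mat_adjoint (G * mat_adjoint M * M) = G * mat_adjoint M * M"
      unfolding XM by (rule Q)
  qed
  then show ?thesis by blast
qed

theorem is_pinv_pinv:
  assumes "M \<in> carrier_mat m n"
  shows "is_pinv M (pinv M)"
  unfolding pinv_def
  by (rule theI') (use pinv_exists[OF assms] pinv_unique[OF _ _ assms] in blast)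

lemma finite_singular_values:
  assumes M: "M \<in> carrier_mat m n"
  shows "finite (singular_values M)"
proof -
  let ?H = "mat_adjoint M * M"
  have H: "?H \<in> carrier_mat n n" using M by auto
  have "finite {e. poly (char_poly ?H) e = 0}"
    using degree_monic_char_poly[OF H] by (intro poly_roots_finite) auto
  then have "finite {e. eigenvalue ?H e}" by (simp add: eigenvalue_root_char_poly[OF H])
  moreover have "inj_on (\<lambda>s. complex_of_real (s\<^sup>2)) (singular_values M)"
    by (auto simp: inj_on_def singular_values_def power2_eq_iff_nonneg simp del: of_real_power)
  moreover have "(\<lambda>s. complex_of_real (s\<^sup>2)) ` singular_values M \<subseteq> {e. eigenvalue ?H e}"
    by (auto simp: singular_values_def)
  ultimately show ?thesis by (meson finite_imageD finite_subset)
qed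

text \<open>The hypothesis \<open>0 < n\<close> guarantees a singular value, so that the maximum defining the norm is
attained.\<close>

theorem norm2_mat_bound:
  assumes M: "M \<in> carrier_mat m n" and n: "0 < n"
  shows "0 \<le> norm2_mat M"
    and "x \<in> carrier_vec n \<Longrightarrow> norm_sq (M *\<^sub>v x) \<le> (norm2_mat M)\<^sup>2 * norm_sq x"
proof -
  obtain V d where V: "unitary_mat n V" and H: "mat_adjoint M * M = spectral_mat V d"
    and d: "\<And>i. i < n \<Longrightarrow> 0 \<le> d i"
    using gram_spectral[OF M] by metis
  have "sqrt (d i) \<in> singular_values M" if "i < n" for i
    using eigenvalue_spectral_mat[OF V that, of d] d[OF that]
    by (simp add: singular_values_def H flip: of_real_power)
  then have le: "sqrt (d i) \<le> norm2_mat M" if "i < n" for i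
    unfolding norm2_mat_def using that finite_singular_values[OF M] by simp
  show "0 \<le> norm2_mat M" using le[OF n] d[OF n] by (meson order.trans real_sqrt_ge_zero)
  have d_le: "d i \<le> (norm2_mat M)\<^sup>2" if "i < n" for i
    using power_mono[OF le[OF that], of 2] d[OF that] by simp
  show "norm_sq (M *\<^sub>v x) \<le> (norm2_mat M)\<^sup>2 * norm_sq x" if x: "x \<in> carrier_vec n"
    unfolding norm_sq_mult_mat_vec[OF M x] H quad_form_spectral_mat[OF V x] norm_sq_coords[OF V x]
      sum_distrib_left
    by (intro sum_mono mult_right_mono d_le) auto
qed

section \<open>Subspaces spanned by eigenvectors\<close>

text \<open>Fewer than \<open>n\<close> homogeneous equations in \<open>n\<close> unknowns: padded with zero rows, the coefficient
matrix is square and singular.\<close>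

lemma exists_orthogonal_vec:
  fixes ws :: "'a :: field vec list"
  assumes ws: "set ws \<subseteq> carrier_vec n" and len: "length ws < n"
  obtains x where "x \<in> carrier_vec n" "x \<noteq> 0\<^sub>v n" "\<And>w. w \<in> set ws \<Longrightarrow> w \<bullet> x = 0"
proof -
  define c where "c i = (if i < length ws then ws ! i else 0\<^sub>v n)" for i
  define M where "M = mat\<^sub>r n n (\<lambda>i. if i = length ws then 0\<^sub>v n else c i)"
  have c: "c i \<in> carrier_vec n" for i
    using subsetD[OF ws nth_mem[of i ws]] by (simp add: c_def)
  have M: "M \<in> carrier_mat n n" by (simp add: M_def)
  have "det M = 0" unfolding M_def by (rule det_row_0[OF len]) (simp add: c)
  then have "\<exists>x. x \<in> carrier_vec n \<and> x \<noteq> 0\<^sub>v n \<and> M *\<^sub>v x = 0\<^sub>v n"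
    by (rule det_0_iff_vec_prod_zero_field[OF M, THEN iffD1])
  then obtain x where x: "x \<in> carrier_vec n" "x \<noteq> 0\<^sub>v n" "M *\<^sub>v x = 0\<^sub>v n"
    by (elim exE conjE)
  have "w \<bullet> x = 0" if "w \<in> set ws" for w
  proof -
    obtain i where i: "i < length ws" "ws ! i = w"
      using \<open>w \<in> set ws\<close>[unfolded in_set_conv_nth] by (elim exE conjE)
    have ii: "i < n" using i(1) len by simp
    have dim: "dim_vec (if i = length ws then 0\<^sub>v n else c i) = n"
      using carrier_vecD[OF c] by simp
    have "row M i = w"
      unfolding M_def row_mat_of_row_fun[where f = "\<lambda>i. if i = length ws then 0\<^sub>v n else c i", OF ii dim]
      using i by (simp add: c_def)
    then have "w \<bullet> x = (M *\<^sub>v x) $ i"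
      using index_mult_mat_vec[of i M x] ii carrier_matD(1)[OF M] by (simp only:)
    then show ?thesis unfolding x(3) using ii by simp
  qed
  then show thesis using that x by blast
qed

text \<open>The columns of \<open>U\<close> indexed by \<open>I\<close> and those of \<open>V\<close> indexed by \<open>J\<close> span subspaces that must
intersect for dimension reasons.\<close>

lemma spectral_subspaces_intersect:
  assumes U: "unitary_mat n U" and V: "unitary_mat n V"
    and I: "I \<subseteq> {..<n}" and J: "J \<subseteq> {..<n}" and card: "n < card I + card J"
  obtains x where "x \<in> carrier_vec n" "x \<noteq> 0\<^sub>v n"
    "\<forall>i<n. i \<notin> I \<longrightarrow> (mat_adjoint U *\<^sub>v x) $ i = 0"
    "\<forall>i<n. i \<notin> J \<longrightarrow> (mat_adjoint V *\<^sub>v x) $ i = 0"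
proof -
  let ?rows = "\<lambda>U I. map (row (mat_adjoint U)) (sorted_list_of_set ({..<n} - I))"
  have fin: "finite I" "finite J" using I J finite_subset by auto
  have cI: "card ({..<n} - I) = n - card I" and cJ: "card ({..<n} - J) = n - card J"
    using card_Diff_subset[OF fin(1) I] card_Diff_subset[OF fin(2) J] by simp_all
  have le: "card I \<le> n" "card J \<le> n" using card_mono[OF _ I] card_mono[OF _ J] by simp_all
  have len: "length (?rows U I @ ?rows V J) < n" using cI cJ card le by simp
  have carr: "set (?rows U I @ ?rows V J) \<subseteq> carrier_vec n"
    using unitary_matD(1)[OF U] unitary_matD(1)[OF V] by (auto intro!: carrier_vecI)
  obtain x where x: "x \<in> carrier_vec n" "x \<noteq> 0\<^sub>v n"
    and orth: "\<And>w. w \<in> set (?rows U I @ ?rows V J) \<Longrightarrow> w \<bullet> x = 0"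
    using exists_orthogonal_vec[OF carr len] by blast
  have "(mat_adjoint U *\<^sub>v x) $ i = 0" if "i < n" "i \<notin> I" for i
    using orth[of "row (mat_adjoint U) i"] that unitary_matD(1)[OF U] by simp
  moreover have "(mat_adjoint V *\<^sub>v x) $ i = 0" if "i < n" "i \<notin> J" for i
    using orth[of "row (mat_adjoint V) i"] that unitary_matD(1)[OF V] by simp
  ultimately show thesis using that x by blast
qed

section \<open>Comparing quadratic forms\<close>

lemma spectral_mat_mono:
  assumes U: "unitary_mat n U" and x: "x \<in> carrier_vec n"
    and le: "\<And>i. i < n \<Longrightarrow> (mat_adjoint U *\<^sub>v x) $ i \<noteq> 0 \<Longrightarrow> d i \<le> e i"
  shows "quad_form (spectral_mat U d) x \<le> quad_form (spectral_mat U e) x"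
  unfolding quad_form_spectral_mat[OF U x]
proof (intro sum_mono)
  fix i assume "i \<in> {..<n}"
  then show "d i * (cmod ((mat_adjoint U *\<^sub>v x) $ i))\<^sup>2 \<le> e i * (cmod ((mat_adjoint U *\<^sub>v x) $ i))\<^sup>2"
    using le[of i] by (cases "(mat_adjoint U *\<^sub>v x) $ i = 0") (auto intro: mult_right_mono simp del: index_mult_mat_vec)
qed

lemma quad_form_spectral_const:
  assumes U: "unitary_mat n U" and x: "x \<in> carrier_vec n"
  shows "quad_form (spectral_mat U (\<lambda>_. c)) x = c * norm_sq x"
  by (simp add: quad_form_spectral_mat[OF U x] norm_sq_coords[OF U x] sum_distrib_left del: index_mult_mat_vec)

lemma quad_form_add:
  assumes "A \<in> carrier_mat n n" "B \<in> carrier_mat n n" "x \<in> carrier_vec n"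
  shows "quad_form (A + B) x = quad_form A x + quad_form B x"
proof -
  note c = mult_mat_vec_carrier[OF assms(1,3)] mult_mat_vec_carrier[OF assms(2,3)]
  have "((A + B) *\<^sub>v x) \<bullet>c x = (A *\<^sub>v x) \<bullet>c x + (B *\<^sub>v x) \<bullet>c x"
    using add_scalar_prod_distrib[OF c carrier_vec_conjugate[OF assms(3)]]
      add_mult_distrib_mat_vec[OF assms] by simp
  then show ?thesis by (simp add: quad_form_def)
qed

text \<open>The numerical radius of a Hermitian matrix does not exceed its spectral radius. The bound is
asked of real eigenvalues only, since there are no others.\<close>

lemma hermitian_quad_form_bound:
  assumes G: "G \<in> carrier_mat n n" "hermitian_mat G" and y: "y \<in> carrier_vec n"
    and eig: "\<And>t z. z \<in> carrier_vec n \<Longrightarrow> z \<noteq> 0\<^sub>v n \<Longrightarrow> G *\<^sub>v z = complex_of_real t \<cdot>\<^sub>v z \<Longrightarrow> \<bar>t\<bar> \<le> k"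
  shows "\<bar>quad_form G y\<bar> \<le> k * norm_sq y"
proof -
  obtain V where V: "unitary_mat n V" and GV: "G = spectral_mat V (\<lambda>i. eigval_desc G (Suc i))"
    using hermitian_spectral_desc[OF G] by metis
  define g where "g = (\<lambda>i. eigval_desc G (Suc i))"
  have GV: "G = spectral_mat V g" using GV by (simp add: g_def)
  have g: "\<bar>g i\<bar> \<le> k" if "i < n" for i
  proof -
    note c = spectral_mat_col[OF V that]
    have "col V i \<noteq> 0\<^sub>v n" using c(2,3) norm_sq_eq_0[of "col V i" n] by auto
    then show ?thesis using eig[OF c(3)] c(1) GV by metis
  qed
  have "quad_form G y \<le> quad_form (spectral_mat V (\<lambda>_. k)) y"
    unfolding GV using g by (intro spectral_mat_mono[OF V y]) (auto simp: abs_le_iff)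
  moreover have "quad_form (spectral_mat V (\<lambda>_. - k)) y \<le> quad_form G y"
    unfolding GV using g by (intro spectral_mat_mono[OF V y]) (force simp: abs_le_iff)
  ultimately show ?thesis by (simp add: quad_form_spectral_const[OF V y] abs_le_iff)
qed

lemma spectral_mat_fixes:
  assumes U: "unitary_mat n U" and x: "x \<in> carrier_vec n"
    and supp: "\<And>i. i < n \<Longrightarrow> d i \<noteq> 1 \<Longrightarrow> (mat_adjoint U *\<^sub>v x) $ i = 0"
  shows "spectral_mat U d *\<^sub>v x = x"
proof -
  have y: "spectral_mat U d *\<^sub>v x \<in> carrier_vec n"
    by (rule mult_mat_vec_carrier[OF spectral_mat_carrier[OF U] x])
  have "mat_adjoint U *\<^sub>v (spectral_mat U d *\<^sub>v x) = mat_adjoint U *\<^sub>v x"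
  proof (rule eq_vecI)
    fix i assume "i < dim_vec (mat_adjoint U *\<^sub>v x)"
    then have i: "i < n" using unitary_matD(1)[OF U] by simp
    show "(mat_adjoint U *\<^sub>v (spectral_mat U d *\<^sub>v x)) $ i = (mat_adjoint U *\<^sub>v x) $ i"
      using supp[OF i] by (cases "d i = 1") (simp_all add: spectral_mat_coords[OF U x i] del: index_mult_mat_vec)
  qed simp
  then show ?thesis using unitary_mult_vec(2)[OF U y] unitary_mult_vec(2)[OF U x] by metis
qed

section \<open>The relative perturbation bound\<close>

text \<open>Here \<open>P\<close> is the projection onto the range of \<open>A\<close> and \<open>N\<close> is the pseudo-inverse of \<open>A\<close>. On the
range of \<open>A\<close> the factor \<open>B\<close> is invertible with inverse \<open>N C = C N\<close>, and the range reduces \<open>B\<close>;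
so, although \<open>B\<close> may be arbitrary on the kernel of \<open>A\<close>, its pseudo-inverse must agree with
that inverse on the range. The proof needs only the two products \<open>X B P = P\<close> and
\<open>P B X = P\<close> for \<open>X = pinv B\<close>: each follows by adjunction from \<open>B X B = B\<close>, and this is
where the Hermitian Penrose equations enter.\<close>

lemma pinv_compressed_to_range:
  assumes U: "unitary_mat n U" and A: "A = spectral_mat U d"
    and B: "B \<in> carrier_mat n n" and C: "C \<in> carrier_mat n n"
    and BC: "A = B * C" "A = C * B"
  defines "P \<equiv> spectral_mat U (\<lambda>i. if d i = 0 then 0 else 1)"
    and "N \<equiv> spectral_mat U (\<lambda>i. inverse (d i))"
  shows "P * pinv B = N * C" "pinv B * P = C * N"
proof -
  define X where "X = pinv B"
  have X: "X \<in> carrier_mat n n" "B * X * B = B" "mat_adjoint (B * X) = B * X" "mat_adjoint (X * B) = X * B"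
    using is_pinv_pinv[OF B] B by (auto simp: is_pinv_def hermitian_mat_def X_def)
  have Pc: "P \<in> carrier_mat n n" and Nc: "N \<in> carrier_mat n n" and Ac: "A \<in> carrier_mat n n"
    by (simp_all add: P_def N_def A spectral_mat_carrier[OF U])
  have aP: "mat_adjoint P = P" by (simp add: P_def spectral_mat_adjoint[OF U])
  note c = Pc Nc Ac B C X(1)
  note ring = assoc_mult_mat[of _ n n _ n _ n] mult_carrier_mat[of _ n n _ n]
  have fn: "(\<lambda>i. inverse (d i) * d i) = (\<lambda>i. if d i = 0 then 0 else 1)"
    "(\<lambda>i. d i * inverse (d i)) = (\<lambda>i. if d i = 0 then 0 else 1)"
    "(\<lambda>i. (if d i = 0 then 0 else 1) * inverse (d i)) = (\<lambda>i. inverse (d i))"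
    "(\<lambda>i. inverse (d i) * (if d i = 0 then 0 else 1)) = (\<lambda>i. inverse (d i))"
    by (rule ext, simp)+
  have NA: "N * A = P" and AN: "A * N = P" and PN: "P * N = N" and NP: "N * P = N"
    by (simp_all add: N_def A P_def spectral_mat_mult[OF U] fn)
  have "C * A = C * (B * C)" using BC(1) by (simp only:)
  also have "\<dots> = A * C" using c by (simp add: BC(2) ring)
  finally have CA: "C * spectral_mat U d = spectral_mat U d * C" by (simp only: A)
  have CP: "C * P = P * C"
    using spectral_mat_commute[OF U C CA, of "\<lambda>t. if t = 0 then 0 else 1"] by (simp add: P_def)
  have "P * (X * B) = N * (C * (B * X * B))"
    unfolding NA[symmetric] BC(2) using c by (simp add: ring)
  also have "\<dots> = P" unfolding X(2) using c by (simp add: NA BC(2)[symmetric])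
  finally have "mat_adjoint (P * (X * B)) = mat_adjoint P" by simp
  then have XBP: "X * B * P = P"
    unfolding mat_adjoint_mult[OF Pc mult_carrier_mat[OF X(1) B]] aP X(4) .
  have "B * X * P = (B * X * B) * (C * N)"
    unfolding AN[symmetric] BC(1) using c by (simp add: ring)
  also have "\<dots> = P" unfolding X(2) AN[symmetric] BC(1) using c by (simp add: ring)
  finally have "mat_adjoint (B * X * P) = mat_adjoint P" by simp
  then have PBX: "P * (B * X) = P"
    unfolding mat_adjoint_mult[OF mult_carrier_mat[OF B X(1)] Pc] aP X(3) .
  have "P * X = N * (A * X)" unfolding NA[symmetric] using c by (simp add: ring)
  also have "\<dots> = (N * P) * (A * X)" unfolding NP ..
  also have "\<dots> = N * (P * (A * X))" using c by (simp add: ring)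
  also have "P * (A * X) = (P * C) * (B * X)" unfolding BC(2) using c by (simp add: ring)
  also have "\<dots> = C * (P * (B * X))" unfolding CP[symmetric] using c by (simp add: ring)
  also have "\<dots> = P * C" unfolding PBX by (rule CP)
  also have "N * (P * C) = (N * P) * C" using c by (simp add: ring)
  finally show "P * pinv B = N * C" unfolding NP X_def .
  have "X * P = (X * A) * N" unfolding AN[symmetric] using c by (simp add: ring)
  also have "\<dots> = (X * A) * (P * N)" unfolding PN ..
  also have "\<dots> = X * (B * (C * P) * N)" unfolding BC(1) using c by (simp add: ring)
  also have "\<dots> = (X * (B * P)) * C * N" unfolding CP using c by (simp add: ring)
  also have "X * (B * P) = P" using XBP c by (simp add: ring)
  also have "P * C * N = C * (P * N)" unfolding CP[symmetric] using c by (simp add: ring)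
  finally show "pinv B * P = C * N" unfolding PN X_def .
qed

text \<open>The claim is \<open>|y\<^sup>* G y| \<le> k |y|\<^sup>2\<close> for the Hermitian matrix \<open>G = T E T\<close> and
\<open>y = |A|\<^bsup>1/2\<^esup> x\<close>. It suffices to bound the eigenvalues \<open>t\<close> of \<open>G\<close>, and the identity
\<open>P A\<^sub>1\<^sup>+ E T = sgn(A) A\<^sub>2 T G\<close> (called \<open>intertwine\<close>) carries an eigenvector \<open>z\<close> of \<open>G\<close> to the
vector \<open>w = A\<^sub>2 T z\<close>, which \<open>P A\<^sub>1\<^sup>+ E A\<^sub>2\<^sup>+\<close> stretches by exactly \<open>|t|\<close>.\<close>

theorem relative_perturbation_bound:
  assumes U: "unitary_mat n U" and A: "A = spectral_mat U d"
    and E: "E \<in> carrier_mat n n" "hermitian_mat E"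
    and A1: "A1 \<in> carrier_mat n n" and A2: "A2 \<in> carrier_mat n n"
    and factors: "A = A1 * A2" "A = A2 * A1"
    and k: "0 \<le> k"
    and K: "\<And>v. v \<in> carrier_vec n \<Longrightarrow> norm_sq ((pinv A1 * E * pinv A2) *\<^sub>v v) \<le> k\<^sup>2 * norm_sq v"
    and x: "x \<in> carrier_vec n"
    and supp: "\<And>i. i < n \<Longrightarrow> d i = 0 \<Longrightarrow> (mat_adjoint U *\<^sub>v x) $ i = 0"
  shows "\<bar>quad_form E x\<bar> \<le> k * quad_form (spectral_mat U (\<lambda>i. \<bar>d i\<bar>)) x"
proof -
  define P where "P = spectral_mat U (\<lambda>i. if d i = 0 then 0 else 1)"
  define N where "N = spectral_mat U (\<lambda>i. inverse (d i))"
  define S where "S = spectral_mat U (\<lambda>i. sgn (d i))"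
  define T where "T = spectral_mat U (\<lambda>i. inverse (sqrt \<bar>d i\<bar>))"
  define R where "R = spectral_mat U (\<lambda>i. sqrt \<bar>d i\<bar>)"
  define X1 where "X1 = pinv A1"
  define X2 where "X2 = pinv A2"
  have X: "X1 \<in> carrier_mat n n" "X2 \<in> carrier_mat n n"
    using is_pinv_pinv[OF A1] is_pinv_pinv[OF A2] A1 A2 by (auto simp: is_pinv_def X1_def X2_def)
  note sc = spectral_mat_carrier[OF U]
  have Pc: "P \<in> carrier_mat n n" and Nc: "N \<in> carrier_mat n n" and Sc: "S \<in> carrier_mat n n"
    and Tc: "T \<in> carrier_mat n n" and Rc: "R \<in> carrier_mat n n" and Ac: "A \<in> carrier_mat n n"
    by (simp_all add: P_def N_def S_def T_def R_def A sc)
  note c = Pc Nc Sc Tc Rc Ac A1 A2 E(1) X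
  note ring = assoc_mult_mat[of _ n n _ n _ n] mult_carrier_mat[of _ n n _ n]
  have "A2 * A = A2 * (A1 * A2)" using factors(1) by (simp only:)
  also have "\<dots> = A * A2" using A1 A2 by (simp add: factors(2) ring)
  finally have A2A: "A2 * spectral_mat U d = spectral_mat U d * A2" by (simp only: A)
  note comm = spectral_mat_commute[OF U A2 A2A]
  have NA2: "A2 * N = N * A2" and SA2: "A2 * S = S * A2" and PA2: "A2 * P = P * A2"
    using comm[of inverse] comm[of sgn] comm[of "\<lambda>t. if t = 0 then 0 else 1"]
    by (simp_all add: N_def S_def P_def)
  have sq: "inverse (sqrt \<bar>t\<bar>) * inverse (sqrt \<bar>t\<bar>) = inverse \<bar>t\<bar>" for t
    by (simp flip: inverse_mult_distrib)
  have mult: "spectral_mat U f * spectral_mat U g = spectral_mat U h" if "\<And>i. f i * g i = h i" for f g h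
    using that by (simp add: spectral_mat_mult[OF U])
  have "T * T = spectral_mat U (\<lambda>i. inverse \<bar>d i\<bar>)" unfolding T_def by (rule mult) (rule sq)
  then have N_eq: "S * (T * T) = N" unfolding S_def N_def by (simp only:) (rule mult, simp add: sgn_if)
  have PT: "P * T = T" unfolding P_def T_def by (rule mult) simp
  have NA: "N * A = P" unfolding P_def N_def A by (rule mult) simp
  have aT: "mat_adjoint T = T" by (simp add: T_def spectral_mat_adjoint[OF U])
  have PX1: "P * X1 = N * A2" and X2P: "X2 * P = A1 * N"
    using pinv_compressed_to_range(1)[OF U A A1 A2 factors]
      pinv_compressed_to_range(2)[OF U A A2 A1 factors(2,1)]
    by (simp_all add: P_def N_def X1_def X2_def)
  have "A1 * A = A1 * (A2 * A1)" using factors(2) by (simp only:)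
  also have "\<dots> = A * A1" using A1 A2 by (simp add: factors(1) ring)
  finally have A1A: "A1 * spectral_mat U d = spectral_mat U d * A1" by (simp only: A)
  have NA1: "A1 * N = N * A1"
    using spectral_mat_commute[OF U A1 A1A, of inverse] by (simp add: N_def)

  define G where "G = T * E * T"
  have Gc: "G \<in> carrier_mat n n" using c by (simp add: G_def ring)
  have Gh: "hermitian_mat G"
    using c E(2) by (simp add: G_def hermitian_mat_def mat_adjoint_mult[of _ n n _ n] ring aT)
  have recover: "(X2 * P) * (A2 * T) = T"
  proof -
    have "(X2 * P) * (A2 * T) = N * ((A1 * A2) * T)" unfolding X2P NA1 using c by (simp add: ring)
    then show ?thesis 
      unfolding factors(1)[symmetric] assoc_mult_mat[OF Nc Ac Tc, symmetric] NA PT .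
  qed
  have intertwine: "(P * X1) * (E * T) = (S * A2) * (T * G)"
  proof -
    have "(P * X1) * (E * T) = (A2 * (S * (T * T))) * (E * T)" unfolding PX1 NA2[symmetric] N_eq ..
    also have "\<dots> = (A2 * S) * (T * G)" using c by (simp add: G_def ring)
    finally show ?thesis unfolding SA2 .
  qed
  have eig: "\<bar>t\<bar> \<le> k"
    if z: "z \<in> carrier_vec n" "z \<noteq> 0\<^sub>v n" and Gz: "G *\<^sub>v z = complex_of_real t \<cdot>\<^sub>v z" for t z
  proof (cases "t = 0")
    case False
    note vc = mult_mat_vec_carrier[of _ n n]
    note va = assoc_mult_mat_vec[of _ n n _ n]
    define w where "w = (A2 * T) *\<^sub>v z"
    have w: "w \<in> carrier_vec n" using c z by (simp add: w_def vc ring)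
    have Tz: "(X2 * P) *\<^sub>v w = T *\<^sub>v z"
      using arg_cong[OF recover, of "\<lambda>M. M *\<^sub>v z"] c z by (simp add: w_def va vc ring)
    \<comment> \<open>If \<open>w\<close> vanished, so would \<open>T z\<close>, hence \<open>G z = t z\<close>, against \<open>t \<noteq> 0\<close>.\<close>
    have w0: "w \<noteq> 0\<^sub>v n"
    proof
      assume "w = 0\<^sub>v n"
      have zero: "Q *\<^sub>v 0\<^sub>v n = 0\<^sub>v n" if "Q \<in> carrier_mat n n" for Q :: "complex mat"
        using carrier_matD[OF that] by (intro eq_vecI) (simp_all add: scalar_prod_def)
      have "T *\<^sub>v z = 0\<^sub>v n"
        using zero[OF mult_carrier_mat[OF X(2) Pc]] Tz by (simp only: \<open>w = 0\<^sub>v n\<close>)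
      moreover have "G *\<^sub>v z = (T * E) *\<^sub>v (T *\<^sub>v z)" using c z by (simp add: G_def va vc ring)
      ultimately have "complex_of_real t \<cdot>\<^sub>v z = 0\<^sub>v n"
        using Gz zero[OF mult_carrier_mat[OF Tc E(1)]] by (simp only:)
      then have "norm_sq (complex_of_real t \<cdot>\<^sub>v z) = 0" using norm_sq_eq_0[of _ n] z by simp
      then show False using False norm_sq_pos[OF z] by (simp add: norm_sq_smult)
    qed
    have Pw: "P *\<^sub>v w = w"
    proof -
      have "P * (A2 * T) = A2 * (P * T)" 
        using PA2 assoc_mult_mat[OF Pc A2 Tc] assoc_mult_mat[OF A2 Pc Tc] by simp
      then have "P * (A2 * T) = A2 * T" unfolding PT .
      then show ?thesis
        using assoc_mult_mat_vec[OF Pc mult_carrier_mat[OF A2 Tc] z(1)] by (simp only: w_def)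
    qed
    have "P *\<^sub>v ((X1 * E * X2) *\<^sub>v w) = P *\<^sub>v ((X1 * E * X2) *\<^sub>v (P *\<^sub>v w))" by (simp only: Pw)
    also have "\<dots> = ((P * X1) * E) *\<^sub>v ((X2 * P) *\<^sub>v w)" using c w by (simp add: va vc ring)
    also have "\<dots> = ((P * X1) * (E * T)) *\<^sub>v z" unfolding Tz using c z by (simp add: va vc ring)
    also have "\<dots> = ((S * A2) * T) *\<^sub>v (G *\<^sub>v z)"
      unfolding intertwine using c z Gc by (simp add: va vc ring)
    also have "\<dots> = complex_of_real t \<cdot>\<^sub>v (((S * A2) * T) *\<^sub>v z)"
      unfolding Gz using c z by (intro mult_mat_vec[of _ n n]) (simp_all add: ring)
    also have "((S * A2) * T) *\<^sub>v z = S *\<^sub>v w" using c z by (simp add: w_def va vc ring)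
    finally have PK: "P *\<^sub>v ((X1 * E * X2) *\<^sub>v w) = complex_of_real t \<cdot>\<^sub>v (S *\<^sub>v w)" .
    have Kw: "(X1 * E * X2) *\<^sub>v w \<in> carrier_vec n" using c w by (simp add: vc ring)
    \<comment> \<open>\<open>sgn(A)\<close> and \<open>P\<close> have the same square, so \<open>sgn(A)\<close> preserves norms on the range of \<open>A\<close>.\<close>
    have "norm_sq (S *\<^sub>v w) = norm_sq (P *\<^sub>v w)"
      unfolding S_def P_def norm_sq_spectral_mat[OF U w]
      by (intro sum.cong refl) (simp add: sgn_if)
    then have "norm_sq (S *\<^sub>v w) = norm_sq w" by (simp only: Pw)
    then have "t\<^sup>2 * norm_sq w = norm_sq (P *\<^sub>v ((X1 * E * X2) *\<^sub>v w))"
      by (simp add: PK norm_sq_smult)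
    also have "\<dots> \<le> norm_sq ((X1 * E * X2) *\<^sub>v w)"
      unfolding P_def norm_sq_spectral_mat[OF U Kw] unfolding norm_sq_coords[OF U Kw]
      by (intro sum_mono) (simp del: index_mult_mat_vec)
    also have "\<dots> \<le> k\<^sup>2 * norm_sq w" using K[OF w] by (simp only: X1_def X2_def)
    finally have "t\<^sup>2 \<le> k\<^sup>2" using norm_sq_pos[OF w w0] by simp
    then show ?thesis using k by (metis abs_le_square_iff abs_of_nonneg)
  qed (use k in simp)
  define y where "y = R *\<^sub>v x"
  have y: "y \<in> carrier_vec n" unfolding y_def by (rule mult_mat_vec_carrier[OF Rc x])
  have "T * R = P" unfolding T_def R_def P_def by (rule mult) simp
  moreover have "P *\<^sub>v x = x"
    unfolding P_def using supp by (intro spectral_mat_fixes[OF U x]) (auto simp del: index_mult_mat_vec split: if_splits)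
  ultimately have Ty: "T *\<^sub>v y = x" using assoc_mult_mat_vec[OF Tc Rc x] by (simp add: y_def)
  have "quad_form E x = quad_form G y"
    using quad_form_conj[OF E(1) Tc y] by (simp only: Ty aT G_def)
  moreover have "norm_sq y = quad_form (spectral_mat U (\<lambda>i. \<bar>d i\<bar>)) x"
    by (simp add: y_def R_def norm_sq_spectral_mat[OF U x] quad_form_spectral_mat[OF U x] del: index_mult_mat_vec)
  ultimately show ?thesis
    using hermitian_quad_form_bound[OF Gc Gh y eig] by simp
qed

section \<open>Relative eigenvalue bounds\<close>

theorem theorem2p5:
  fixes n r :: nat
    and A E A1 A2 :: "complex mat"
    and lam :: "nat \<Rightarrow> real"
    and k :: real
  assumes A: "A \<in> carrier_mat n n" "hermitian_mat A"
    and rank: "vec_space.rank n A = r" "r \<le> n"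
    and lam_eigvals:
      "eigvals_mset A = image_mset (\<lambda>i. complex_of_real (lam i)) (mset_set {1..n})"
    and lam_decreasing: "\<And>i j. 1 \<le> i \<Longrightarrow> i \<le> j \<Longrightarrow> j \<le> r \<Longrightarrow> lam j \<le> lam i"
    and lam_nonzero: "\<And>i. 1 \<le> i \<Longrightarrow> i \<le> r \<Longrightarrow> lam i \<noteq> 0"
    and lam_zero: "\<And>i. r < i \<Longrightarrow> i \<le> n \<Longrightarrow> lam i = 0"
    and E: "E \<in> carrier_mat n n" "hermitian_mat E"
    and A1: "A1 \<in> carrier_mat n n"
    and A2: "A2 \<in> carrier_mat n n"
    and factors: "A = A1 * A2" "A = A2 * A1"
    and k: "k = norm2_mat (pinv A1 * E * pinv A2)" "k \<le> 1"
  shows "\<forall>i\<in>{1..r}.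
           eigval_desc (A + E) (n - r + i) \<le> lam i + k * \<bar>lam i\<bar> \<and>
           eigval_desc (A + E) i \<ge> lam i - k * \<bar>lam i\<bar>"
proof
  fix i assume i: "i \<in> {1..r}"
  \<comment> \<open>Rows and columns of matrices are counted from \<open>0\<close>, eigenvalues from \<open>1\<close>.\<close>
  define p where "p = i - 1"
  have p: "p < r" "i = Suc p" using i by (auto simp: p_def)
  have n: "0 < n" and pn: "p < n" using p rank(2) by auto
  define d where "d = (\<lambda>j. lam (Suc j))"
  have "mset_set {1..n} = image_mset Suc (mset_set {..<n})"
    by (subst image_mset_mset_set) (auto simp: image_Suc_lessThan)
  then have "eigvals_mset A = image_mset (\<lambda>j. complex_of_real (d j)) (mset_set {..<n})"
    unfolding lam_eigvals by (simp add: multiset.map_comp o_def d_def)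
  then obtain U where U: "unitary_mat n U" and AU: "A = spectral_mat U d"
    using hermitian_spectral[OF A] by blast
  have M: "A + E \<in> carrier_mat n n" using A E by simp
  have Mh: "hermitian_mat (A + E)"
    using A E by (simp add: hermitian_mat_def mat_adjoint_add[of _ n n])
  obtain V where V: "unitary_mat n V"
    and MV: "A + E = spectral_mat V (\<lambda>i. eigval_desc (A + E) (Suc i))"
    and desc: "\<And>i j. i \<le> j \<Longrightarrow> j < n \<Longrightarrow> eigval_desc (A + E) (Suc j) \<le> eigval_desc (A + E) (Suc i)"
    using hermitian_spectral_desc[OF M Mh] by blast
  define mu where "mu = (\<lambda>i. eigval_desc (A + E) (Suc i))"
  have MV: "A + E = spectral_mat V mu" using MV by (simp add: mu_def)
  have Kc: "pinv A1 * E * pinv A2 \<in> carrier_mat n n"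
    using is_pinv_pinv[OF A1] is_pinv_pinv[OF A2] A1 A2 E by (auto simp: is_pinv_def)
  have k0: "0 \<le> k" using norm2_mat_bound(1)[OF Kc n] by (simp add: k)
  have perturb: "\<bar>quad_form (A + E) x - quad_form (spectral_mat U d) x\<bar>
      \<le> k * quad_form (spectral_mat U (\<lambda>i. \<bar>d i\<bar>)) x"
    if x: "x \<in> carrier_vec n" and supp: "\<And>j. j < n \<Longrightarrow> r \<le> j \<Longrightarrow> (mat_adjoint U *\<^sub>v x) $ j = 0" for x
  proof -
    have "(mat_adjoint U *\<^sub>v x) $ j = 0" if "j < n" "d j = 0" for j
      using supp[of j] lam_nonzero[of "Suc j"] that by (cases "r \<le> j") (auto simp: d_def simp del: index_mult_mat_vec)
    then have "\<bar>quad_form E x\<bar> \<le> k * quad_form (spectral_mat U (\<lambda>i. \<bar>d i\<bar>)) x"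
      using norm2_mat_bound(2)[OF Kc n]
      by (intro relative_perturbation_bound[OF U AU E A1 A2 factors k0 _ x]) (auto simp: k)
    then show ?thesis using quad_form_add[OF A(1) E(1) x] AU by simp
  qed
  have combine: "quad_form (spectral_mat U d) x + s * quad_form (spectral_mat U (\<lambda>i. \<bar>d i\<bar>)) x
      = quad_form (spectral_mat U (\<lambda>i. d i + s * \<bar>d i\<bar>)) x" if "x \<in> carrier_vec n" for x s
    unfolding quad_form_spectral_mat[OF U that] sum_distrib_left sum.distrib[symmetric]
    by (intro sum.cong refl) (simp add: algebra_simps del: index_mult_mat_vec)
  \<comment> \<open>\<open>|s| \<le> 1\<close> makes \<open>t + s |t|\<close> nondecreasing; it is used for \<open>s = k\<close> and for \<open>s = - k\<close>.\<close>
  have mono: "a + s * \<bar>a\<bar> \<le> b + s * \<bar>b\<bar>" if "a \<le> b" "\<bar>s\<bar> \<le> 1" for a b s :: real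
  proof -
    have "s * (\<bar>a\<bar> - \<bar>b\<bar>) \<le> \<bar>s\<bar> * \<bar>\<bar>a\<bar> - \<bar>b\<bar>\<bar>" by (metis abs_ge_self abs_mult)
    also have "\<dots> \<le> 1 * \<bar>a - b\<bar>" using that(2) by (intro mult_mono) auto
    finally show ?thesis using that(1) by (simp add: algebra_simps)
  qed
  have upper: "mu (n - r + p) \<le> d p + k * \<bar>d p\<bar>"
  proof -
    \<comment> \<open>\<open>(r - p) + (n - r + p + 1) = n + 1\<close>\<close>
    have card: "n < card {p..<r} + card {..n - r + p}" using p rank(2) by simp
    have sub: "{p..<r} \<subseteq> {..<n}" "{..n - r + p} \<subseteq> {..<n}" using p rank(2) by auto
    obtain x where x: "x \<in> carrier_vec n" "x \<noteq> 0\<^sub>v n"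
      and xU: "\<forall>j<n. j \<notin> {p..<r} \<longrightarrow> (mat_adjoint U *\<^sub>v x) $ j = 0"
      and xV: "\<forall>j<n. j \<notin> {..n - r + p} \<longrightarrow> (mat_adjoint V *\<^sub>v x) $ j = 0"
      by (rule spectral_subspaces_intersect[OF U V sub card])
    have "mu (n - r + p) * norm_sq x \<le> quad_form (A + E) x"
      unfolding MV quad_form_spectral_const[OF V x(1), symmetric]
    proof (rule spectral_mat_mono[OF V x(1)])
      fix j assume "j < n" "(mat_adjoint V *\<^sub>v x) $ j \<noteq> 0"
      then have "j \<le> n - r + p" using xV by (auto simp del: index_mult_mat_vec)
      moreover have "n - r + p < n" using p rank(2) by simp
      ultimately show "mu (n - r + p) \<le> mu j" unfolding mu_def by (rule desc)
    qed
    also have "\<dots> \<le> quad_form (spectral_mat U (\<lambda>i. d i + k * \<bar>d i\<bar>)) x"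
    proof -
      have "(mat_adjoint U *\<^sub>v x) $ j = 0" if "j < n" "r \<le> j" for j using xU that by simp
      from perturb[OF x(1) this] show ?thesis unfolding combine[OF x(1), of k, symmetric] by linarith
    qed
    also have "\<dots> \<le> (d p + k * \<bar>d p\<bar>) * norm_sq x"
      unfolding quad_form_spectral_const[OF U x(1), symmetric]
    proof (rule spectral_mat_mono[OF U x(1)])
      fix j assume "j < n" "(mat_adjoint U *\<^sub>v x) $ j \<noteq> 0"
      then have "p \<le> j" "j < r" using xU by (auto simp del: index_mult_mat_vec)
      then have "d j \<le> d p" using lam_decreasing[of "Suc p" "Suc j"] by (simp add: d_def)
      then show "d j + k * \<bar>d j\<bar> \<le> d p + k * \<bar>d p\<bar>" using k0 k(2) by (intro mono) auto
    qed
    finally show ?thesis using norm_sq_pos[OF x] by simp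
  qed
  have lower: "d p - k * \<bar>d p\<bar> \<le> mu p"
  proof -
    have card: "n < card {..p} + card {p..<n}" using pn by simp
    have sub: "{..p} \<subseteq> {..<n}" "{p..<n} \<subseteq> {..<n}" using pn by auto
    obtain x where x: "x \<in> carrier_vec n" "x \<noteq> 0\<^sub>v n"
      and xU: "\<forall>j<n. j \<notin> {..p} \<longrightarrow> (mat_adjoint U *\<^sub>v x) $ j = 0"
      and xV: "\<forall>j<n. j \<notin> {p..<n} \<longrightarrow> (mat_adjoint V *\<^sub>v x) $ j = 0"
      by (rule spectral_subspaces_intersect[OF U V sub card])
    have "(d p - k * \<bar>d p\<bar>) * norm_sq x \<le> quad_form (spectral_mat U (\<lambda>i. d i + (- k) * \<bar>d i\<bar>)) x"
      unfolding quad_form_spectral_const[OF U x(1), symmetric]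
    proof (rule spectral_mat_mono[OF U x(1)])
      fix j assume "j < n" "(mat_adjoint U *\<^sub>v x) $ j \<noteq> 0"
      then have "j \<le> p" using xU by (auto simp del: index_mult_mat_vec)
      then have "d p \<le> d j" using lam_decreasing[of "Suc j" "Suc p"] p(1) by (simp add: d_def)
      then show "d p - k * \<bar>d p\<bar> \<le> d j + (- k) * \<bar>d j\<bar>" using mono[of "d p" "d j" "- k"] k0 k(2) by simp
    qed
    also have "\<dots> \<le> quad_form (A + E) x"
    proof -
      have "(mat_adjoint U *\<^sub>v x) $ j = 0" if "j < n" "r \<le> j" for j using xU p(1) that by simp
      from perturb[OF x(1) this] show ?thesis unfolding combine[OF x(1), of "- k", symmetric] by linarith
    qed
    also have "\<dots> \<le> mu p * norm_sq x"
      unfolding MV quad_form_spectral_const[OF V x(1), symmetric]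
    proof (rule spectral_mat_mono[OF V x(1)])
      fix j assume j: "j < n" "(mat_adjoint V *\<^sub>v x) $ j \<noteq> 0"
      then have "p \<le> j" using xV by (auto simp del: index_mult_mat_vec)
      then show "mu j \<le> mu p" unfolding mu_def using j(1) by (rule desc)
    qed
    finally show ?thesis using norm_sq_pos[OF x] by simp
  qed
  show "eigval_desc (A + E) (n - r + i) \<le> lam i + k * \<bar>lam i\<bar> \<and>
      eigval_desc (A + E) i \<ge> lam i - k * \<bar>lam i\<bar>"
    using upper lower by (simp add: mu_def d_def p(2))
qed

end
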